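(* Let $X=\{x_1,\dots,x_n\}\subset\mathbb{R}^p$ be in general position about $t$, let $n>p(p-1)$, and let $u$ satisfy the conditions listed in the context, with $K=\sup_{s>0}su(s)>p$. Then $\delta^*(X)=\min\{1/K,\,1-p/K\}$ if $n+1>K$, and $\delta^*(X)=0$ if $n+1\le K$.
   Context: Fix a dimension $p$, a center $t\in\mathbb{R}^p$ and a function $u:[0,\infty)\to\mathbb{R}$. Put $\psi(s)=su(s)$ and $K=\sup_{s>0}\psi(s)$. Conditions on $u$: (i) $u(s)$ is non-negative, non-increasing and continuous for $s>0$; (ii) $u(s)$ and $su(s)$ are bounded; (iii) $\psi$ is non-decreasing on $s>0$ and strictly increasing on $\{s>0:\psi(s)<K\}$; (iv) $K>p$. For a finite collection (multiset) $Z=\{z_1,\dots,z_N\}$ of points of $\mathbb{R}^p$, the $M$-estimate of scatter $V_N(Z)$ about $t$ is a symmetric positive definite matrix $V$ satisfying $$V=\frac1N\sum_{i=1}^N u(s_i)(z_i-t)(z_i-t)',\qquad s_i=(z_i-t)'V^{-1}(z_i-t).$$ We say $V_N(Z)$ exists if such a $V$ exists. $X=\{x_1,\dots,x_n\}$ is in general position about $t$ if for every $p$ of the points, the vectors $x_i-t$ span $\mathbb{R}^p$. Under the assumptions made ($X$ in general position about $t$, $n>p(p-1)$), $V_n(X)$ exists and is unique. For $m\ge1$ and a multiset $Y=\{y_1,\dots,y_m\}$ of arbitrary points of $\mathbb{R}^p$, let $Z=X\cup Y$ be the combined multiset of $n+m$ points, and $\epsilon_m=m/(n+m)$. Let $S_m(X)$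 be the set of $Z=X\cup Y$ for which $V_{n+m}(Z)$ exists (it is then unique). The maximum bias $b(\epsilon_m;X)$ is $\infty$ if some $Y$ of size $m$ gives $Z\notin S_m(X)$, and otherwise $$b(\epsilon_m;X)=\sup_Y \mathrm{trace}\{V_{n+m}(Z)V_n(X)^{-1}+V_n(X)V_{n+m}(Z)^{-1}\},$$ the supremum being over all $Y$ of size $m$. $\delta^*(X)$ denotes a fraction such that, for all $m\ge1$, $b(\epsilon_m;X)=\infty$ if $\epsilon_m>\delta^*(X)$ and $b(\epsilon_m;X)<\infty$ if $\epsilon_m<\delta^*(X)$. It is not unique, since the values $\epsilon_m$ are discrete; "$\delta^*(X)=c$" means that $c$ has this property. *)

theory Defs
  imports "HOL-Analysis.Analysis" "HOL-Library.Multiset"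
begin

definition psi :: "(real \<Rightarrow> real) \<Rightarrow> real \<Rightarrow> real" where
  "psi u s = s * u s"

definition psi_sup :: "(real \<Rightarrow> real) \<Rightarrow> real" where
  "psi_sup u = (SUP s\<in>{0<..}. psi u s)"

text \<open>
  The weight function is defined on the half-line $[0,\infty)$; it is modelled as a total function
  on the reals whose values at negative arguments are never used.  The supremum in
  \<open>psi_sup\<close> is a genuine one because of the boundedness conditions.
\<close>

definition scatter_weight :: "(real \<Rightarrow> real) \<Rightarrow> bool" where
  "scatter_weight u \<longleftrightarrow>
     (\<forall>s>0. 0 \<le> u s) \<and> antimono_on {0<..} u \<and> continuous_on {0<..} u \<and>
     bounded (u ` {0..}) \<and> bounded (psi u ` {0..}) \<and>
     mono_on {0<..} (psi u) \<and> strict_mono_on {s. 0 < s \<and> psi u s < psi_sup u} (psi u)"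

definition sym_pos_def :: "real^'p^'p \<Rightarrow> bool" where
  "sym_pos_def V \<longleftrightarrow> transpose V = V \<and> (\<forall>x. x \<noteq> 0 \<longrightarrow> 0 < x \<bullet> (V *v x))"

definition outer_self :: "real^'p \<Rightarrow> real^'p^'p" where
  "outer_self x = (\<chi> i j. x $ i * x $ j)"

definition sq_dist_about :: "real^'p \<Rightarrow> real^'p^'p \<Rightarrow> real^'p \<Rightarrow> real" where
  "sq_dist_about t V z = (z - t) \<bullet> (matrix_inv V *v (z - t))"

definition is_scatter :: "(real \<Rightarrow> real) \<Rightarrow> real^'p \<Rightarrow> (real^'p) multiset \<Rightarrow> real^'p^'p \<Rightarrow> bool" where
  "is_scatter u t Z V \<longleftrightarrow> sym_pos_def V \<and>
     V = (1 / real (size Z)) *\<^sub>R (\<Sum>z\<in>#Z. u (sq_dist_about t V z) *\<^sub>R outer_self (z - t))"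

definition scatter_exists :: "(real \<Rightarrow> real) \<Rightarrow> real^'p \<Rightarrow> (real^'p) multiset \<Rightarrow> bool" where
  "scatter_exists u t Z \<longleftrightarrow> (\<exists>V. is_scatter u t Z V)"

text \<open>
  The choice operator returns the unique solution whenever there is exactly one, and some
  solution whenever there is at least one.  The latter matters when the contamination fraction is
  exactly critical: for $p = 1$, if the supremum of \<open>psi u\<close> is attained, it can happen that the
  defining equation has a whole interval of solutions.
\<close>

definition scatter :: "(real \<Rightarrow> real) \<Rightarrow> real^'p \<Rightarrow> (real^'p) multiset \<Rightarrow> real^'p^'p" where
  "scatter u t Z = (SOME V. is_scatter u t Z V)"

text \<open>
  Submultisets select points with their multiplicity, so repeated points are excluded when
  \<open>1 < CARD('p)\<close>.
\<close>

definition general_position_about :: "real^'p \<Rightarrow> (real^'p) multiset \<Rightarrow> bool" where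
  "general_position_about t X \<longleftrightarrow>
     (\<forall>A. A \<subseteq># X \<and> size A = CARD('p) \<longrightarrow> span ((\<lambda>x. x - t) ` set_mset A) = UNIV)"

definition contam_fraction :: "'a multiset \<Rightarrow> nat \<Rightarrow> real" where
  "contam_fraction X m = real m / real (size X + m)"

definition max_bias :: "(real \<Rightarrow> real) \<Rightarrow> real^'p \<Rightarrow> (real^'p) multiset \<Rightarrow> nat \<Rightarrow> ereal" where
  "max_bias u t X m =
     (if \<exists>Y. size Y = m \<and> \<not> scatter_exists u t (X + Y) then \<infinity>
      else (SUP Y\<in>{Y. size Y = m}.
        ereal (trace (scatter u t (X + Y) ** matrix_inv (scatter u t X) +
                      scatter u t X ** matrix_inv (scatter u t (X + Y))))))"

definition is_breakdown_fraction ::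
    "(real \<Rightarrow> real) \<Rightarrow> real^'p \<Rightarrow> (real^'p) multiset \<Rightarrow> real \<Rightarrow> bool" where
  "is_breakdown_fraction u t X \<delta> \<longleftrightarrow>
     (\<forall>m\<ge>1. (contam_fraction X m > \<delta> \<longrightarrow> max_bias u t X m = \<infinity>) \<and>
            (contam_fraction X m < \<delta> \<longrightarrow> max_bias u t X m < \<infinity>))"

end

theory Submission
  imports Defs
begin

text \<open>
  Let \<open>n\<close>, \<open>m\<close> be the sizes of the data and the contamination, \<open>N = n + m\<close>, and let \<open>p\<close> be the
  dimension.  The right-hand side of the scatter equation is monotone in \<open>V\<close> for the Loewner order,
  and a subsolution satisfies the inequality \<open>\<Sum> u(s\<^sub>i) (v'V\<inverse>x\<^sub>i)\<^sup>2 \<le> N v'V\<inverse>v\<close> over the data points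
  alone.  If \<open>N p < n K\<close>, this bounds \<open>V\<inverse>\<close> uniformly in the contamination: the matrices cannot
  degenerate, since in the limit the points off the kernel of the rescaled \<open>V\<inverse>\<close> would contribute
  \<open>K\<close> each, against at most \<open>N\<close> times the rank.  Hence monotone iteration converges to a solution.
  If moreover \<open>m K < N\<close>, then \<open>V\<close> is bounded as well, because a contaminating point contributes at
  most \<open>K w'Vw\<close> to \<open>N w'Vw\<close>.  Conversely, contamination at the centre \<open>t\<close> destroys existence when
  \<open>N p > n K\<close> (take traces), and contamination far out in one direction makes \<open>V\<close> unbounded when
  \<open>N \<le> m K\<close>.
\<close>

subsection \<open>Symmetric matrices\<close>

definition pos_semidef :: "real^'p^'p \<Rightarrow> bool" where
  "pos_semidef M \<longleftrightarrow> transpose M = M \<and> (\<forall>x. 0 \<le> x \<bullet> (M *v x))"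

lemma inner_symmetric_matrix:
  fixes M :: "real^'p^'p"
  assumes "transpose M = M"
  shows "(M *v x) \<bullet> y = x \<bullet> (M *v y)"
  by (metis assms dot_lmul_matrix transpose_matrix_vector)

lemma sym_pos_def_imp_pos_semidef: "sym_pos_def M \<Longrightarrow> pos_semidef M"
  unfolding sym_pos_def_def pos_semidef_def by (metis inner_zero_left less_eq_real_def)

text \<open>The form is non-negative on all combinations of \<open>x\<close> and \<open>y\<close>;
  the coefficients \<open>r = c\<close>, \<open>s = - b\<close> give c (c a - b^2), from which a
  positive \<open>c\<close> cancels.\<close>

lemma pos_semidef_Cauchy_Schwarz:
  assumes "pos_semidef M"
  shows "(x \<bullet> (M *v y))\<^sup>2 \<le> (x \<bullet> (M *v x)) * (y \<bullet> (M *v y))"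
proof -
  define a b c where "a = x \<bullet> (M *v x)" and "b = x \<bullet> (M *v y)" and "c = y \<bullet> (M *v y)"
  have sym: "y \<bullet> (M *v x) = b"
    using assms inner_symmetric_matrix[of M y x]
    by (simp add: pos_semidef_def b_def inner_commute)
  have ge: "0 \<le> r\<^sup>2 * a + 2 * r * s * b + s\<^sup>2 * c" for r s
  proof -
    have "0 \<le> (r *\<^sub>R x + s *\<^sub>R y) \<bullet> (M *v (r *\<^sub>R x + s *\<^sub>R y))"
      using assms by (simp add: pos_semidef_def)
    also have "\<dots> = r\<^sup>2 * a + 2 * r * s * b + s\<^sup>2 * c"
      using sym by (simp add: a_def b_def c_def matrix_vector_right_distrib
          matrix_vector_mult_scaleR inner_add_left inner_add_right power2_eq_square algebra_simps)
    finally show ?thesis .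
  qed
  have a: "0 \<le> a" and c: "0 \<le> c"
    using assms by (auto simp: pos_semidef_def a_def c_def)
  show ?thesis
  proof (cases "c = 0")
    case True
    have "b = 0"
    proof (rule ccontr)
      assume "b \<noteq> 0"
      \<comment> \<open>With \<open>c = 0\<close> the form at \<open>r = 1\<close> is affine in
        \<open>s\<close>, and this \<open>s\<close> would give it the value -1.\<close>
      then show False
        using ge[of 1 "- (a + 1) / (2 * b)"] True by (simp add: field_simps)
    qed
    then show ?thesis by (simp add: True flip: a_def b_def c_def)
  next
    case False
    then have "0 < c" using c by simp
    have "0 \<le> c * (c * a - b\<^sup>2)"
      using ge[of c "- b"] by (simp add: power2_eq_square algebra_simps)
    then have "0 \<le> c * a - b\<^sup>2"
      using \<open>0 < c\<close> by (simp add: zero_le_mult_iff)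
    then show ?thesis by (simp add: mult.commute flip: a_def b_def c_def)
  qed
qed

text \<open>By Cauchy-Schwarz a null vector \<open>x\<close> of the form is
  \<open>M\<close>-orthogonal to every vector, in particular to \<open>M *v x\<close>.\<close>

lemma pos_semidef_quadratic_form_eq_0:
  assumes "pos_semidef M"
  shows "x \<bullet> (M *v x) = 0 \<longleftrightarrow> M *v x = 0"
proof
  assume "x \<bullet> (M *v x) = 0"
  then have "((M *v x) \<bullet> (M *v x))\<^sup>2 \<le> 0"
    using pos_semidef_Cauchy_Schwarz[OF assms, of "M *v x" x] by simp
  then show "M *v x = 0" by simp
qed simp

text \<open>Definiteness makes the kernel trivial, hence \<open>V\<close> invertible. The form of
  the inverse at \<open>x\<close> is the form of \<open>V\<close> at
  \<open>matrix_inv V *v x\<close>.\<close>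

lemma sym_pos_def_inverse:
  fixes V :: "real^'p^'p"
  assumes "sym_pos_def V"
  shows "V ** matrix_inv V = mat 1" "matrix_inv V ** V = mat 1" "sym_pos_def (matrix_inv V)"
proof -
  have V: "transpose V = V" "\<And>x. x \<noteq> 0 \<Longrightarrow> 0 < x \<bullet> (V *v x)"
    using assms by (auto simp: sym_pos_def_def)
  have "\<exists>B. B ** V = mat 1"
    unfolding matrix_left_invertible_ker
    by (metis V(2) inner_zero_right less_irrefl)
  then have "invertible V"
    using invertible_left_inverse by blast
  then have "V ** matrix_inv V = mat 1 \<and> matrix_inv V ** V = mat 1"
    unfolding invertible_def matrix_inv_def by (rule someI_ex)
  then show inv: "V ** matrix_inv V = mat 1" "matrix_inv V ** V = mat 1" by auto
  have "transpose (matrix_inv V) ** V = mat 1"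
    using inv(1) V(1) by (metis matrix_transpose_mul transpose_mat)
  then have tr: "transpose (matrix_inv V) = matrix_inv V"
    by (metis inv(1) matrix_mul_assoc matrix_mul_lid matrix_mul_rid)
  have "0 < x \<bullet> (matrix_inv V *v x)" if "x \<noteq> 0" for x
  proof -
    have Vx: "V *v (matrix_inv V *v x) = x"
      by (simp add: matrix_vector_mul_assoc inv)
    then have "matrix_inv V *v x \<noteq> 0" using that by auto
    from V(2)[OF this] show ?thesis
      by (simp add: Vx inner_commute)
  qed
  with tr show "sym_pos_def (matrix_inv V)" by (simp add: sym_pos_def_def)
qed

lemma matrix_inv_unique:
  fixes V :: "real^'p^'p"
  assumes "sym_pos_def V" "V ** A = mat 1"
  shows "matrix_inv V = A"
  by (metis assms matrix_mul_assoc matrix_mul_lid matrix_mul_rid sym_pos_def_inverse(2))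

lemma sym_pos_def_mult_inverse_vector [simp]:
  fixes V :: "real^'p^'p"
  assumes "sym_pos_def V"
  shows "V *v (matrix_inv V *v x) = x" "matrix_inv V *v (V *v x) = x"
  using assms by (simp_all add: matrix_vector_mul_assoc sym_pos_def_inverse)

text \<open>Cauchy-Schwarz for \<open>V\<close> at \<open>x\<close> and
  \<open>matrix_inv V *v y\<close>. It serves to compare the squared projection of a point with its
  squared distance.\<close>

lemma sym_pos_def_dual_Cauchy_Schwarz:
  fixes V :: "real^'p^'p"
  assumes "sym_pos_def V"
  shows "(x \<bullet> y)\<^sup>2 \<le> (x \<bullet> (V *v x)) * (y \<bullet> (matrix_inv V *v y))"
  using pos_semidef_Cauchy_Schwarz[OF sym_pos_def_imp_pos_semidef[OF assms],
      of x "matrix_inv V *v y"] assms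
  by (simp add: inner_commute)

text \<open>For \<open>y = matrix_inv V' *v x\<close> both \<open>y \<bullet> x\<close> and the form
  of \<open>V'\<close> at \<open>y\<close> equal the left-hand side, so dual Cauchy-Schwarz for
  \<open>V\<close> leaves the claim after cancelling one factor.\<close>

lemma sym_pos_def_inverse_antimono:
  fixes V V' :: "real^'p^'p"
  assumes V: "sym_pos_def V" and V': "sym_pos_def V'"
    and le: "\<And>x. x \<bullet> (V *v x) \<le> x \<bullet> (V' *v x)"
  shows "x \<bullet> (matrix_inv V' *v x) \<le> x \<bullet> (matrix_inv V *v x)"
proof (cases "x = 0")
  case False
  define y where "y = matrix_inv V' *v x"
  have y: "y \<bullet> x = x \<bullet> y" "V' *v y = x" "0 < x \<bullet> y"
    using V' False sym_pos_def_inverse(3)[OF V'] 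
    by (auto simp: y_def inner_commute sym_pos_def_def)
  have "(y \<bullet> x)\<^sup>2 \<le> (y \<bullet> (V *v y)) * (x \<bullet> (matrix_inv V *v x))"
    by (rule sym_pos_def_dual_Cauchy_Schwarz[OF V])
  also have "\<dots> \<le> (y \<bullet> (V' *v y)) * (x \<bullet> (matrix_inv V *v x))"
    using sym_pos_def_inverse(3)[OF V, THEN sym_pos_def_imp_pos_semidef]
    by (intro mult_right_mono le) (auto simp: pos_semidef_def)
  finally show ?thesis
    using y by (simp add: power2_eq_square y_def[symmetric])
qed simp

section \<open>Matrix entries, quadratic forms and limits\<close>

lemma inner_axis_matrix: "axis i 1 \<bullet> (M *v axis j 1) = (M :: real^'p^'p) $ i $ j"
  by (simp add: inner_axis' matrix_vector_mul_component inner_axis)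

lemma symmetric_matrix_component_polarization:
  fixes M :: "real^'p^'p"
  assumes "transpose M = M"
  defines "Q \<equiv> \<lambda>x. x \<bullet> (M *v x)"
  shows "M $ i $ j = 1 / 2 * (Q (axis i 1 + axis j 1) - Q (axis i 1) - Q (axis j 1))"
proof -
  have "axis j 1 \<bullet> (M *v axis i 1) = axis i 1 \<bullet> (M *v axis j (1::real))"
    using inner_symmetric_matrix[OF assms(1)] by (metis inner_commute)
  then show ?thesis
    by (simp add: Q_def matrix_vector_right_distrib inner_add_left inner_add_right
        flip: inner_axis_matrix)
qed

text \<open>By polarization every entry is a combination of three values of the form. This suits
  sequences that are monotone in the Loewner order, where convergence is first known for the
  forms.\<close>

lemma convergent_quadratic_forms_imp_convergent:
  fixes M :: "nat \<Rightarrow> real^'p^'p"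
  assumes "\<And>k. transpose (M k) = M k" "\<And>x. convergent (\<lambda>k. x \<bullet> (M k *v x))"
  shows "convergent M"
proof -
  have "convergent (\<lambda>k. M k $ i $ j)" for i j
    unfolding symmetric_matrix_component_polarization[OF assms(1)]
    by (intro convergent_diff convergent_mult convergent_const assms)
  then obtain L where "\<And>i j. (\<lambda>k. M k $ i $ j) \<longlonglongrightarrow> L i j"
    unfolding convergent_def by metis
  then have "M \<longlonglongrightarrow> (\<chi> i j. L i j)"
    by (intro vec_tendstoI) simp
  then show ?thesis by (auto simp: convergent_def)
qed

lemma tendsto_matrix_vector_mult [tendsto_intros]:
  fixes M :: "'b \<Rightarrow> real^'m^'n"
  assumes "(M \<longlongrightarrow> L) F"
  shows "((\<lambda>k. M k *v x) \<longlongrightarrow> L *v x) F"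
  unfolding matrix_vector_mult_def
  by (intro vec_tendstoI) (auto intro!: tendsto_intros assms)

lemma tendsto_matrix_mult:
  fixes M :: "'b \<Rightarrow> real^'m^'n" and M' :: "'b \<Rightarrow> real^'k^'m"
  assumes "(M \<longlongrightarrow> L) F" "(M' \<longlongrightarrow> L') F"
  shows "((\<lambda>k. M k ** M' k) \<longlongrightarrow> L ** L') F"
  unfolding matrix_matrix_mult_def
  by (intro vec_tendstoI) (auto intro!: tendsto_intros assms)

lemma tendsto_transpose:
  fixes M :: "'b \<Rightarrow> real^'m^'n"
  assumes "(M \<longlongrightarrow> L) F"
  shows "((\<lambda>k. transpose (M k)) \<longlongrightarrow> transpose L) F"
  unfolding transpose_def
  by (intro vec_tendstoI) (auto intro!: tendsto_intros assms)

lemma pos_semidef_LIMSEQ: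
  fixes M :: "nat \<Rightarrow> real^'p^'p"
  assumes "M \<longlonglongrightarrow> L" "\<And>k. pos_semidef (M k)"
  shows "pos_semidef L"
proof -
  have "(\<lambda>k. transpose (M k)) \<longlonglongrightarrow> L"
    using assms by (simp add: pos_semidef_def)
  then have "transpose L = L"
    using tendsto_transpose[OF assms(1)] LIMSEQ_unique by blast
  moreover have "0 \<le> x \<bullet> (L *v x)" for x
    by (rule LIMSEQ_le_const[where X = "\<lambda>k. x \<bullet> (M k *v x)"])
      (use assms in \<open>auto intro!: tendsto_intros simp: pos_semidef_def\<close>)
  ultimately show ?thesis by (simp add: pos_semidef_def)
qed

text \<open>Axis vectors bound the diagonal; Cauchy-Schwarz for two axis vectors passes the bound on
  to the other entries.\<close>

lemma pos_semidef_abs_component_le: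
  fixes M :: "real^'p^'p"
  assumes "pos_semidef M" "\<And>x. x \<bullet> (M *v x) \<le> C * (x \<bullet> x)"
  shows "\<bar>M $ i $ j\<bar> \<le> C"
proof -
  have le: "M $ k $ k \<le> C" "0 \<le> M $ k $ k" for k
    using assms(2)[of "axis k 1"] assms(1)[unfolded pos_semidef_def, THEN conjunct2, rule_format, of "axis k 1"]
    by (simp_all add: inner_axis_matrix)
  have "(M $ i $ j)\<^sup>2 \<le> M $ i $ i * M $ j $ j"
    using pos_semidef_Cauchy_Schwarz[OF assms(1), of "axis i 1" "axis j 1"]
    by (simp add: inner_axis_matrix)
  also have "\<dots> \<le> C * C"
    using le[of i] le[of j] by (intro mult_mono) auto
  finally show ?thesis
    using le[of i] by (metis abs_le_square_iff abs_of_nonneg order_trans power2_eq_square)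
qed

section \<open>Rank-one matrices, traces and a rank bound\<close>

lemma inner_outer_self: "w \<bullet> (outer_self z *v v) = (w \<bullet> z) * (z \<bullet> v)"
proof -
  have "outer_self z *v v = (z \<bullet> v) *\<^sub>R z"
    by (vector outer_self_def matrix_vector_mult_def inner_vec_def)
      (simp add: sum_distrib_left sum_distrib_right mult_ac)
  then show ?thesis by (simp add: mult.commute)
qed

lemma outer_self_symmetric: "transpose (outer_self z) = outer_self z"
  by (simp add: transpose_def outer_self_def mult.commute)

lemma trace_outer_self_mult: "trace (outer_self z ** M) = z \<bullet> (M *v z)"
proof -
  have "trace (outer_self z ** M) = (\<Sum>i\<in>UNIV. \<Sum>k\<in>UNIV. z $ i * z $ k * M $ k $ i)"
    by (simp add: trace_def matrix_matrix_mult_def outer_self_def)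
  also have "\<dots> = (\<Sum>k\<in>UNIV. \<Sum>i\<in>UNIV. z $ i * z $ k * M $ k $ i)"
    by (rule sum.swap)
  also have "\<dots> = z \<bullet> (M *v z)"
    by (simp add: inner_vec_def matrix_vector_mult_def sum_distrib_left mult_ac)
  finally show ?thesis .
qed

text \<open>Subtracting \<open>(Bv)(Bv)'\<close> with \<open>v'Bv = 1\<close> lowers the rank by one, so a
  \<open>B\<close>-orthonormal basis of a complement of the kernel is used implicitly.\<close>

lemma sum_mset_quadratic_form_le_rank:
  fixes B :: "real^'p^'p" and W :: "(real^'p) multiset"
  assumes "0 \<le> N" and "pos_semidef B"
    and "\<And>v. (\<Sum>x\<in>#W. c x * (v \<bullet> (B *v x))\<^sup>2) \<le> N * (v \<bullet> (B *v v))"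
  shows "(\<Sum>x\<in>#W. c x * (x \<bullet> (B *v x))) \<le> N * (real CARD('p) - real (dim {x. B *v x = 0}))"
  using assms
proof (induction "CARD('p) - dim {x. B *v x = 0}" arbitrary: B rule: less_induct)
  case less
  note N = less.prems(1) and psd = less.prems(2) and ineq = less.prems(3)
  have sym: "(B *v x) \<bullet> y = x \<bullet> (B *v y)" for x y
    using psd by (simp add: pos_semidef_def inner_symmetric_matrix)
  have subsp: "subspace {x. M *v x = 0}" for M :: "real^'p^'p"
    by (auto simp: subspace_def algebra_simps)
  have dim_le: "dim {x. M *v x = 0} \<le> CARD('p)" for M :: "real^'p^'p"
    by (rule dim_subset_UNIV_cart)
  show ?case
  proof (cases "B = 0")
    case True
    then show ?thesis by (simp add: dim_UNIV)
  next
    case False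
    then obtain v0 where "B *v v0 \<noteq> 0"
      by (metis matrix_eq matrix_vector_mult_0)
    then have pos: "0 < v0 \<bullet> (B *v v0)"
      using psd pos_semidef_quadratic_form_eq_0[OF psd, of v0]
      by (metis less_eq_real_def pos_semidef_def)
    define v where "v = (1 / sqrt (v0 \<bullet> (B *v v0))) *\<^sub>R v0"
    have v1: "v \<bullet> (B *v v) = 1"
      using pos by (simp add: v_def matrix_vector_mult_scaleR)
    define B' where "B' = B - outer_self (B *v v)"
    have B'v: "w \<bullet> (B' *v x) = w \<bullet> (B *v x) - (v \<bullet> (B *v w)) * (v \<bullet> (B *v x))" for w x
      using sym by (simp add: B'_def matrix_vector_mult_diff_rdistrib inner_diff_right
          inner_outer_self inner_commute)
    have psd': "pos_semidef B'"
      unfolding pos_semidef_def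
    proof (intro conjI allI)
      have "transpose B' = transpose B - transpose (outer_self (B *v v))"
        by (simp add: B'_def transpose_def vec_eq_iff)
      then show "transpose B' = B'"
        using psd by (simp add: outer_self_symmetric pos_semidef_def B'_def)
      show "0 \<le> x \<bullet> (B' *v x)" for x
        using pos_semidef_Cauchy_Schwarz[OF psd, of v x] by (simp add: B'v v1 power2_eq_square)
    qed
    have "{x. B *v x = 0} \<subset> {x. B' *v x = 0}"
    proof (intro psubsetI subsetI)
      show "x \<in> {x. B' *v x = 0}" if "x \<in> {x. B *v x = 0}" for x
        using that B'v[of x x] pos_semidef_quadratic_form_eq_0[OF psd', of x] by simp
      have "v \<in> {x. B' *v x = 0} - {x. B *v x = 0}"
        using v1 B'v[of v v] pos_semidef_quadratic_form_eq_0[OF psd', of v] by auto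
      then show "{x. B *v x = 0} \<noteq> {x. B' *v x = 0}" by blast
    qed
    then have dim_less: "dim {x. B *v x = 0} < dim {x. B' *v x = 0}"
      by (intro dim_psubset) (simp add: span_eq_iff[THEN iffD2, OF subsp])
    have "(\<Sum>x\<in>#W. c x * (w \<bullet> (B' *v x))\<^sup>2) \<le> N * (w \<bullet> (B' *v w))" for w
    proof -
      \<comment> \<open>\<open>w'\<close> is the \<open>B\<close>-projection of \<open>w\<close>
        away from \<open>v\<close>; the hypothesis on \<open>B\<close> at \<open>w'\<close> is the
        one required of \<open>B'\<close> at \<open>w\<close>.\<close>
      define w' where "w' = w - (v \<bullet> (B *v w)) *\<^sub>R v"
      have w'B: "w' \<bullet> (B *v x) = w \<bullet> (B' *v x)" for x
        by (simp add: w'_def B'v inner_diff_left)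
      have "w' \<bullet> (B *v w') = w \<bullet> (B' *v w)"
        unfolding w'B using sym[of v w]
      by (simp add: w'_def B'v v1 algebra_simps inner_diff_right inner_commute)
      then show ?thesis using ineq[of w'] by (simp add: w'B)
    qed
    then have "(\<Sum>x\<in>#W. c x * (x \<bullet> (B' *v x))) \<le> N * (real CARD('p) - real (dim {x. B' *v x = 0}))"
      using less.hyps[of B'] N psd' dim_less dim_le[of B'] by simp
    moreover have "(\<Sum>x\<in>#W. c x * (x \<bullet> (B *v x)))
        = (\<Sum>x\<in>#W. c x * (v \<bullet> (B *v x))\<^sup>2) + (\<Sum>x\<in>#W. c x * (x \<bullet> (B' *v x)))"
      by (simp add: B'v power2_eq_square algebra_simps flip: sum_mset.distrib)
    moreover have "(\<Sum>x\<in>#W. c x * (v \<bullet> (B *v x))\<^sup>2) \<le> N"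
      using ineq[of v] v1 by simp
    \<comment> \<open>The kernel gains at least one dimension, which pays for the \<open>N\<close>
      spent on the split-off rank-one part.\<close>
    moreover have "N * 1 \<le> N * (real (dim {x. B' *v x = 0}) - real (dim {x. B *v x = 0}))"
      using dim_less N by (intro mult_left_mono) auto
    ultimately show ?thesis
      by (simp add: right_diff_distrib)
  qed
qed

subsection \<open>General position\<close>

lemma exists_submultiset_size:
  assumes "k \<le> size M"
  shows "\<exists>A. A \<subseteq># M \<and> size A = k"
  using assms
proof (induction M arbitrary: k)
  case (add x M)
  show ?case
  proof (cases k)
    case (Suc j)
    with add obtain A where "A \<subseteq># M" "size A = j" by fastforce
    then show ?thesis
      using Suc by (intro exI[of _ "add_mset x A"]) simp
  qed (auto intro: exI[of _ "{#}"])
qed simp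

lemma tendsto_sum_mset:
  fixes f :: "'a \<Rightarrow> 'b \<Rightarrow> 'c::topological_comm_monoid_add"
  assumes "\<And>x. x \<in># W \<Longrightarrow> ((\<lambda>k. f k x) \<longlongrightarrow> g x) F"
  shows "((\<lambda>k. \<Sum>x\<in>#W. f k x) \<longlongrightarrow> (\<Sum>x\<in>#W. g x)) F"
  using assms by (induction W) (auto intro!: tendsto_intros)

lemma sum_mset_nonneg:
  fixes f :: "'a \<Rightarrow> real"
  assumes "\<And>x. x \<in># W \<Longrightarrow> 0 \<le> f x"
  shows "0 \<le> (\<Sum>x\<in>#W. f x)"
  using sum_mset_mono[of W "\<lambda>_. 0" f] assms by simp

lemma sum_mset_member_le:
  fixes f :: "'a \<Rightarrow> real"
  assumes "\<And>x. x \<in># W \<Longrightarrow> 0 \<le> f x" "a \<in># W"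
  shows "f a \<le> (\<Sum>x\<in>#W. f x)"
proof -
  obtain W' where "W = add_mset a W'"
    using assms(2) by (metis insert_DiffM)
  then show ?thesis
    using sum_mset_nonneg[of W' f] assms(1) by simp
qed

lemma card_set_mset_le_size: "card (set_mset M) \<le> size M"
  by (induction M) (auto simp: card_insert_if)

text \<open>Stated for centred points. Counting points in proper subspaces, with multiplicity, is
  the form needed once a limit matrix has a kernel.\<close>

definition in_general_position :: "(real^'p) multiset \<Rightarrow> bool" where
  "in_general_position W \<longleftrightarrow> CARD('p) \<le> size W \<and>
     (\<forall>L. subspace L \<and> L \<noteq> UNIV \<longrightarrow> size {#x \<in># W. x \<in> L#} \<le> dim L)"

text \<open>Fewer than p points lie in \<open>L\<close>, since p of them would have to span.
  Completing these, \<open>Q\<close>, to p points gives a spanning set inside the span of a basis of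
  \<open>L\<close> and the p - |Q| added points, so p is at most dim \<open>L\<close> + p -
  |Q|.\<close>

lemma general_position_about_imp_in_general_position:
  fixes X :: "(real^'p) multiset"
  assumes gp: "general_position_about t X" and size: "CARD('p) \<le> size X"
  shows "in_general_position (image_mset (\<lambda>x. x - t) X)"
  unfolding in_general_position_def
proof (intro conjI allI impI)
  fix L :: "(real^'p) set"
  assume "subspace L \<and> L \<noteq> UNIV"
  then have L: "subspace L" "L \<noteq> UNIV" by auto
  define Q where "Q = {#x \<in># X. x - t \<in> L#}"
  have Q: "Q \<subseteq># X" and QL: "(\<lambda>x. x - t) ` set_mset Q \<subseteq> L" by (auto simp: Q_def)
  have less: "size Q < CARD('p)"
  proof (rule ccontr)
    assume "\<not> size Q < CARD('p)"
    then obtain A where A: "A \<subseteq># Q" "size A = CARD('p)"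
      using exists_submultiset_size[of "CARD('p)" Q] by auto
    then have "span ((\<lambda>x. x - t) ` set_mset A) = UNIV"
      using gp Q by (auto simp: general_position_about_def)
    moreover have "span ((\<lambda>x. x - t) ` set_mset A) \<subseteq> L"
      using A(1) QL L(1) by (intro span_minimal) (auto dest: set_mset_mono)
    ultimately show False using L(2) by auto
  qed
  have "CARD('p) - size Q \<le> size (X - Q)"
    using size Q by (simp add: size_Diff_submset)
  then obtain R where R: "R \<subseteq># X - Q" "size R = CARD('p) - size Q"
    using exists_submultiset_size by blast
  then have "Q + R \<subseteq># X" "size (Q + R) = CARD('p)"
    using Q less by (auto simp: subset_mset.le_diff_conv2 add.commute)
  then have span: "span ((\<lambda>x. x - t) ` set_mset (Q + R)) = UNIV"
    using gp unfolding general_position_about_def by blast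
  obtain b where b: "finite b" "L \<subseteq> span b" "card b = dim L"
    using basis_exists[of L] finiteI_independent by metis
  define R' where "R' = (\<lambda>x. x - t) ` set_mset R"
  have "(\<lambda>x. x - t) ` set_mset (Q + R) \<subseteq> span (b \<union> R')"
    using QL b(2) span_mono[of b "b \<union> R'"] span_superset[of "b \<union> R'"]
    by (auto simp: R'_def)
  then have "UNIV \<subseteq> span (b \<union> R')"
    by (metis span span_minimal subspace_span)
  then have "CARD('p) \<le> card (b \<union> R')"
    using dim_le_card[of UNIV "b \<union> R'"] b(1) by (simp add: dim_UNIV R'_def)
  also have "\<dots> \<le> dim L + card R'"
    using card_Un_le[of b R'] b(3) by simp
  also have "card R' \<le> size R"
    unfolding R'_def using card_image_le[of "set_mset R"] card_set_mset_le_size[of R]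
    by (meson finite_set_mset order_trans)
  finally have "size Q \<le> dim L"
    using R(2) less by simp
  then show "size {#x \<in># image_mset (\<lambda>x. x - t) X. x \<in> L#} \<le> dim L"
    by (simp add: Q_def filter_mset_image_mset comp_def)
qed (use size in simp)

lemma in_general_position_nonzero:
  assumes "in_general_position (W :: (real^'p) multiset)" "x \<in># W"
  shows "x \<noteq> 0"
proof
  assume "x = 0"
  have "{0} \<noteq> (UNIV :: (real^'p) set)"
    by (metis UNIV_I axis_eq_0_iff singletonD zero_neq_one)
  then have "size {#x \<in># W. x \<in> {0}#} \<le> 0"
    using assms(1) by (auto simp: in_general_position_def dest!: spec[of _ "{0}"])
  then show False
    using \<open>x = 0\<close> assms(2) by simp
qed

text \<open>Otherwise the hyperplane orthogonal to \<open>w\<close>, of dimension below p, would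
  contain all of the at least p points.\<close>

lemma in_general_position_orthogonal_eq_0:
  assumes "in_general_position (W :: (real^'p) multiset)" "\<And>x. x \<in># W \<Longrightarrow> w \<bullet> x = 0"
  shows "w = 0"
proof (rule ccontr)
  assume "w \<noteq> 0"
  define L where "L = {x. w \<bullet> x = 0}"
  have L: "subspace L" "L \<noteq> UNIV"
    using \<open>w \<noteq> 0\<close> by (auto simp: L_def subspace_hyperplane set_eq_iff dest: spec[of _ w])
  have "dim L < CARD('p)"
    using dim_psubset[of L UNIV] L by (simp add: span_eq_iff[THEN iffD2, OF L(1)] dim_UNIV psubset_eq)
  moreover have "{#x \<in># W. x \<in> L#} = W"
    using assms(2) by (simp add: L_def filter_mset_eq_conv)
  ultimately show False
    using assms(1) L by (fastforce simp: in_general_position_def dest: spec[of _ L])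
qed

subsection \<open>Weight functions and the lower bound\<close>

locale weight_function =
  fixes u :: "real \<Rightarrow> real"
  assumes weight: "scatter_weight u" and psi_sup_pos: "0 < psi_sup u"
begin

lemma weight_bounded: "\<exists>B>0. \<forall>s\<ge>0. \<bar>u s\<bar> \<le> B"
proof -
  have "bounded (u ` {0..})" using weight by (simp add: scatter_weight_def)
  then show ?thesis by (auto simp: bounded_pos)
qed

lemma weight_nonneg: "0 < s \<Longrightarrow> 0 \<le> u s"
  using weight by (simp add: scatter_weight_def)

lemma psi_mono: "0 < s \<Longrightarrow> s \<le> s' \<Longrightarrow> psi u s \<le> psi u s'"
  using weight by (auto simp: scatter_weight_def mono_on_def)

lemma psi_bdd_above: "bdd_above (psi u ` {0<..})"
proof -
  have "bounded (psi u ` {0..})" using weight by (simp add: scatter_weight_def)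
  then have "bdd_above (psi u ` {0..})" by (rule bounded_imp_bdd_above)
  then show ?thesis by (rule bdd_above_mono) auto
qed

text \<open>The supremum ranges over positive \<open>s\<close>; at \<open>s = 0\<close> the
  left-hand side is 0 whatever \<open>u 0\<close> is.\<close>

lemma psi_le_psi_sup: "0 \<le> s \<Longrightarrow> psi u s \<le> psi_sup u"
  using psi_sup_pos cSUP_upper[OF _ psi_bdd_above, of s]
  by (cases "s = 0") (auto simp: psi_sup_def psi_def)

text \<open>If \<open>u s = 0\<close>, then \<open>psi u\<close> is at most 0 at both
  \<open>s / 2\<close> and \<open>s\<close>, so both lie where it increases strictly, and
  \<open>psi u (s / 2)\<close> would be negative.\<close>

lemma weight_pos:
  assumes "0 < s"
  shows "0 < u s"
proof (rule ccontr)
  assume "\<not> 0 < u s"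
  then have "u s = 0" using weight_nonneg[OF assms] by simp
  then have s: "psi u s = 0" by (simp add: psi_def)
  have "psi u (s / 2) \<le> psi u s" using assms by (intro psi_mono) auto
  then have "s / 2 \<in> {s. 0 < s \<and> psi u s < psi_sup u}" "s \<in> {s. 0 < s \<and> psi u s < psi_sup u}"
    using assms s psi_sup_pos by auto
  moreover have "strict_mono_on {s. 0 < s \<and> psi u s < psi_sup u} (psi u)"
    using weight by (simp add: scatter_weight_def)
  ultimately have "psi u (s / 2) < psi u s"
    using assms by (simp add: strict_mono_onD[of "{s. 0 < s \<and> psi u s < psi_sup u}" "psi u" "s / 2" s])
  then show False
    using s weight_nonneg[of "s / 2"] assms by (simp add: psi_def mult_less_0_iff)
qed

lemma psi_pos: "0 < s \<Longrightarrow> 0 < psi u s"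
  by (simp add: psi_def weight_pos)

lemma psi_tendsto_psi_sup: "(psi u \<longlongrightarrow> psi_sup u) at_top"
proof (rule order_tendstoI)
  fix a assume "a < psi_sup u"
  then obtain s where "0 < s" "a < psi u s"
    unfolding psi_sup_def by (subst (asm) less_cSUP_iff) (auto simp: psi_bdd_above)
  then show "eventually (\<lambda>s. a < psi u s) at_top"
    unfolding eventually_at_top_linorder by (meson less_le_trans psi_mono)
next
  fix a assume "psi_sup u < a"
  then show "eventually (\<lambda>s. psi u s < a) at_top"
    unfolding eventually_at_top_linorder by (meson le_less_trans psi_le_psi_sup)
qed

text \<open>If the matrices \<open>A\<close> were unbounded, their normalisations would accumulate at a
  singular \<open>B\<close>.  Every point outside the kernel of \<open>B\<close> then has weight \<open>psi_sup u\<close> in the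
  limit, whereas the kernel contains no more points than its dimension.\<close>

lemma inverse_scatter_bounded:
  fixes W :: "(real^'p) multiset"
  assumes gp: "in_general_position W" and N: "0 \<le> N"
    and few: "N * real CARD('p) < real (size W) * psi_sup u"
  shows "\<exists>C>0. \<forall>A. sym_pos_def A \<and>
      (\<forall>v. (\<Sum>x\<in>#W. u (x \<bullet> (A *v x)) * (v \<bullet> (A *v x))\<^sup>2) \<le> N * (v \<bullet> (A *v v)))
      \<longrightarrow> norm A \<le> C"
proof (rule ccontr)
  define P where "P = (\<lambda>A::real^'p^'p. sym_pos_def A \<and>
      (\<forall>v. (\<Sum>x\<in>#W. u (x \<bullet> (A *v x)) * (v \<bullet> (A *v x))\<^sup>2) \<le> N * (v \<bullet> (A *v v))))"
  assume "\<not> ?thesis"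
  then have "\<not> (\<exists>C>0. \<forall>A. P A \<longrightarrow> norm A \<le> C)"
    unfolding P_def .
  then have "\<exists>A. P A \<and> norm A > real k + 1" for k :: nat
    by (auto simp: not_le dest: spec[of _ "real k + 1"])
  then obtain A where A: "\<And>k. P (A k)" "\<And>k. norm (A k) > real k + 1"
    by metis
  define b where "b = (\<lambda>k. (1 / norm (A k)) *\<^sub>R A k)"
  have nz: "norm (A k) > 0" for k
    using A(2)[of k] by linarith
  have "b k \<in> sphere 0 1" for k
    using nz[of k] by (simp add: b_def)
  \<comment> \<open>Compactness of the unit sphere. The limit has norm 1, so it is nonzero, but it
    need only be semidefinite.\<close>
  then obtain B r where B: "B \<in> sphere 0 1" "strict_mono r" "(b \<circ> r) \<longlonglongrightarrow> B"
    using compact_sphere[of "0::real^'p^'p" 1] unfolding compact_def by metis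
  define a where "a = (\<lambda>k. norm (A (r k)))"
  have a: "a k > 0" for k unfolding a_def by (rule nz)
  define Bk where "Bk = b \<circ> r"
  have lim: "Bk \<longlonglongrightarrow> B" using B by (simp add: Bk_def)
  have Ar: "A (r k) = a k *\<^sub>R Bk k" for k
    by (cases "A (r k) = 0") (simp_all add: a_def Bk_def b_def)
  have a_top: "filterlim a at_top sequentially"
  proof (rule filterlim_at_top_mono[OF filterlim_real_sequentially])
    show "eventually (\<lambda>k. real k \<le> a k) sequentially"
    proof (intro always_eventually allI)
      fix k show "real k \<le> a k"
        using A(2)[of "r k"] seq_suble[OF B(2), of k] by (simp add: a_def)
    qed
  qed
  have pos: "0 < x \<bullet> (Bk k *v x)" if "x \<noteq> 0" for x k
    using A(1)[of "r k"] that a[of k]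
    by (auto simp: P_def sym_pos_def_def Ar zero_less_mult_iff simp flip: scaleR_matrix_vector_assoc)
  have sym: "transpose (Bk k) = Bk k" for k
    using A(1)[of "r k"] by (auto simp: P_def sym_pos_def_def Bk_def b_def transpose_scalar)
  have psd: "pos_semidef (Bk k)" for k
    by (intro sym_pos_def_imp_pos_semidef) (simp add: sym_pos_def_def sym pos)
  have psdB: "pos_semidef B"
    using lim psd by (rule pos_semidef_LIMSEQ)
  \<comment> \<open>Off the kernel of \<open>B\<close>, \<open>ck k x\<close> is the weight of
    \<open>x\<close> multiplied by \<open>a k\<close>, rewritten through \<open>psi\<close> so that
    it has a limit. Points in the kernel are dropped, which only decreases the sum; for them
    \<open>c x\<close> is 0 because division by zero gives 0.\<close>
  define c where "c = (\<lambda>x. psi_sup u / (x \<bullet> (B *v x)))"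
  define ck where "ck = (\<lambda>k x. if B *v x = 0 then 0
      else psi u (a k * (x \<bullet> (Bk k *v x))) / (x \<bullet> (Bk k *v x)))"
  have ck: "(\<lambda>k. ck k x) \<longlonglongrightarrow> c x" for x
  proof (cases "B *v x = 0")
    case False
    then have Bx: "0 < x \<bullet> (B *v x)"
      using psdB pos_semidef_quadratic_form_eq_0[OF psdB, of x]
      by (metis less_eq_real_def pos_semidef_def)
    have conv: "(\<lambda>k. x \<bullet> (Bk k *v x)) \<longlonglongrightarrow> x \<bullet> (B *v x)"
      by (intro tendsto_intros lim)
    have "filterlim (\<lambda>k. (x \<bullet> (Bk k *v x)) * a k) at_top sequentially"
      by (rule filterlim_tendsto_pos_mult_at_top[OF conv Bx a_top])
    then have "(\<lambda>k. psi u (a k * (x \<bullet> (Bk k *v x)))) \<longlonglongrightarrow> psi_sup u"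
      by (intro filterlim_compose[OF psi_tendsto_psi_sup]) (simp add: mult.commute)
    then show ?thesis
      using False Bx by (simp add: ck_def c_def tendsto_divide[OF _ conv])
  qed (simp add: ck_def c_def)
  have ineq_k: "(\<Sum>x\<in>#W. ck k x * (v \<bullet> (Bk k *v x))\<^sup>2) \<le> N * (v \<bullet> (Bk k *v v))" for k v
  proof -
    have "a k * (\<Sum>x\<in>#W. ck k x * (v \<bullet> (Bk k *v x))\<^sup>2)
        = (\<Sum>x\<in>#W. a k * (ck k x * (v \<bullet> (Bk k *v x))\<^sup>2))"
      by (rule sum_mset_distrib_left)
    also have "\<dots> \<le> (\<Sum>x\<in>#W. u (x \<bullet> (A (r k) *v x)) * (v \<bullet> (A (r k) *v x))\<^sup>2)"
    proof (rule sum_mset_mono)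
      fix x assume "x \<in># W"
      show "a k * (ck k x * (v \<bullet> (Bk k *v x))\<^sup>2) \<le> u (x \<bullet> (A (r k) *v x)) * (v \<bullet> (A (r k) *v x))\<^sup>2"
      proof (cases "x = 0")
        case False
        define q where "q = x \<bullet> (Bk k *v x)"
        have q: "0 < q" using pos[OF False] by (simp add: q_def)
        have s: "x \<bullet> (A (r k) *v x) = a k * q" "v \<bullet> (A (r k) *v x) = a k * (v \<bullet> (Bk k *v x))"
          by (simp_all add: Ar q_def flip: scaleR_matrix_vector_assoc)
        show ?thesis
          using q a[of k] weight_nonneg[of "a k * q"]
          by (cases "B *v x = 0") (simp_all add: ck_def s psi_def power2_eq_square flip: q_def)
      qed simp
    qed
    also have "\<dots> \<le> N * (v \<bullet> (A (r k) *v v))"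
      using A(1) by (simp add: P_def)
    also have "\<dots> = a k * (N * (v \<bullet> (Bk k *v v)))"
      by (simp add: Ar flip: scaleR_matrix_vector_assoc)
    finally show ?thesis using a[of k] by simp
  qed
  have "(\<Sum>x\<in>#W. c x * (v \<bullet> (B *v x))\<^sup>2) \<le> N * (v \<bullet> (B *v v))" for v
  proof (rule LIMSEQ_le)
    show "(\<lambda>k. \<Sum>x\<in>#W. ck k x * (v \<bullet> (Bk k *v x))\<^sup>2) \<longlonglongrightarrow> (\<Sum>x\<in>#W. c x * (v \<bullet> (B *v x))\<^sup>2)"
      by (intro tendsto_sum_mset tendsto_intros ck lim)
    show "(\<lambda>k. N * (v \<bullet> (Bk k *v v))) \<longlonglongrightarrow> N * (v \<bullet> (B *v v))"
      by (intro tendsto_intros lim)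
  qed (use ineq_k in blast)
  from sum_mset_quadratic_form_le_rank[OF N psdB this]
  have rank: "(\<Sum>x\<in>#W. c x * (x \<bullet> (B *v x))) \<le> N * (real CARD('p) - real (dim {x. B *v x = 0}))" .
  define d where "d = dim {x. B *v x = 0}"
  have subsp: "subspace {x. B *v x = 0}"
    by (auto simp: subspace_def algebra_simps)
  have "B \<noteq> 0" using B(1) by auto
  then obtain y where "B *v y \<noteq> 0"
    by (metis matrix_eq matrix_vector_mult_0)
  then have proper: "{x. B *v x = 0} \<noteq> UNIV" by auto
  then have d: "d < CARD('p)"
    using dim_psubset[of "{x. B *v x = 0}" UNIV] subsp
    by (simp add: span_eq_iff[THEN iffD2, OF subsp] dim_UNIV psubset_eq d_def)
  have "size {#x \<in># W. x \<in> {x. B *v x = 0}#} \<le> d"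
    using gp subsp proper unfolding in_general_position_def d_def by blast
  then have q: "size {#x \<in># W. B *v x = 0#} \<le> d" by simp
  have "(\<Sum>x\<in>#W. c x * (x \<bullet> (B *v x))) = (\<Sum>x\<in>#W. if B *v x = 0 then 0 else psi_sup u)"
    using pos_semidef_quadratic_form_eq_0[OF psdB]
    by (intro arg_cong[where f = sum_mset] image_mset_cong) (auto simp: c_def)
  also have "\<dots> = psi_sup u * (real (size W) - real (size {#x \<in># W. B *v x = 0#}))"
    by (induction W) (auto simp: algebra_simps)
  also have "\<dots> \<ge> psi_sup u * (real (size W) - real d)"
    using q psi_sup_pos by (intro mult_left_mono) auto
  finally have "psi_sup u * (real (size W) - d) \<le> N * (real CARD('p) - d)"
    using rank by (simp add: d_def)
  \<comment> \<open>The factor p allows \<open>few\<close> to be used. What remains is 0 < K d (p -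
    n) with n = \<open>size W\<close>, against p \<le> n from general position.\<close>
  then have "real CARD('p) * (psi_sup u * (real (size W) - d)) \<le> real CARD('p) * (N * (real CARD('p) - d))"
    by (intro mult_left_mono) auto
  also have "\<dots> = (N * real CARD('p)) * (real CARD('p) - d)" by simp
  also have "\<dots> < (real (size W) * psi_sup u) * (real CARD('p) - d)"
    using few d by (intro mult_strict_right_mono) auto
  finally have "0 < psi_sup u * (d * (real CARD('p) - real (size W)))"
    by (simp add: algebra_simps)
  moreover have "psi_sup u * (d * (real CARD('p) - real (size W))) \<le> 0"
    using gp psi_sup_pos unfolding in_general_position_def
    by (intro mult_nonneg_nonpos) auto
  ultimately show False by linarith
qed

end

subsection \<open>Existence and the upper bound\<close>

text \<open>Right-hand side of the scatter equation for centred points. The argument is the inverse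
  of the scatter matrix, so that limits can be taken for matrix and inverse separately.\<close>

definition scatter_sum :: "(real \<Rightarrow> real) \<Rightarrow> (real^'p) multiset \<Rightarrow> real^'p^'p \<Rightarrow> real^'p^'p" where
  "scatter_sum u Z A =
     (1 / real (size Z)) *\<^sub>R (\<Sum>z\<in>#Z. u (z \<bullet> (A *v z)) *\<^sub>R outer_self z)"

lemma is_scatter_iff_scatter_sum:
  "is_scatter u t Z V \<longleftrightarrow> sym_pos_def V \<and>
     V = scatter_sum u (image_mset (\<lambda>z. z - t) Z) (matrix_inv V)"
  by (simp add: is_scatter_def scatter_sum_def sq_dist_about_def multiset.map_comp comp_def)

lemma inner_scatter_sum:
  "w \<bullet> (scatter_sum u Z A *v v) = (\<Sum>z\<in>#Z. u (z \<bullet> (A *v z)) * ((w \<bullet> z) * (z \<bullet> v))) / real (size Z)"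
proof -
  have "w \<bullet> ((\<Sum>z\<in>#Z. c z *\<^sub>R outer_self z) *v v) = (\<Sum>z\<in>#Z. c z * ((w \<bullet> z) * (z \<bullet> v)))" for c
    by (induction Z) (auto simp: matrix_vector_mult_add_rdistrib inner_add_right inner_outer_self
        simp flip: scaleR_matrix_vector_assoc)
  then show ?thesis
    by (simp add: scatter_sum_def flip: scaleR_matrix_vector_assoc)
qed

lemma inner_scatter_sum_self:
  "w \<bullet> (scatter_sum u Z A *v w) = (\<Sum>z\<in>#Z. u (z \<bullet> (A *v z)) * (w \<bullet> z)\<^sup>2) / real (size Z)"
  by (simp add: inner_scatter_sum power2_eq_square inner_commute)

text \<open>With \<open>M = A\<close> the summands are values of \<open>psi\<close>; with
  \<open>M\<close> from another data set the formula compares two estimates.\<close>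

lemma trace_scatter_sum_mult:
  "trace (scatter_sum u Z A ** M) = (\<Sum>z\<in>#Z. u (z \<bullet> (A *v z)) * (z \<bullet> (M *v z))) / real (size Z)"
proof -
  have add: "trace ((P + Q) ** M) = trace (P ** M) + trace (Q ** M)"
    and scale: "trace ((r *\<^sub>R P) ** M) = r * trace (P ** M)" for P Q and r :: real
    by (simp_all add: trace_def matrix_matrix_mult_def sum.distrib sum_distrib_left algebra_simps)
  have "trace ((\<Sum>z\<in>#Z. c z *\<^sub>R outer_self z) ** M) = (\<Sum>z\<in>#Z. c z * (z \<bullet> (M *v z)))" for c
    by (induction Z) (simp_all add: add scale trace_outer_self_mult, simp add: trace_def)
  then show ?thesis
    by (simp add: scatter_sum_def scale)
qed

lemma scatter_sum_symmetric: "transpose (scatter_sum u Z A) = scatter_sum u Z A"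
proof -
  have "transpose (\<Sum>z\<in>#Z. c z *\<^sub>R outer_self z) = (\<Sum>z\<in>#Z. c z *\<^sub>R outer_self z)" for c
  proof (induction Z)
    case (add z Z)
    have "transpose (P + Q) = transpose P + transpose Q" for P Q :: "real^'a^'a"
      by (simp add: transpose_def vec_eq_iff)
    with add show ?case by (simp add: transpose_scalar outer_self_symmetric)
  qed (simp add: transpose_def vec_eq_iff)
  then show ?thesis by (simp add: scatter_sum_def transpose_scalar)
qed

text \<open>Cauchy-Schwarz in each row. The factor p is crude, but only boundedness matters
  later.\<close>

lemma quadratic_form_le_norm:
  fixes A :: "real^'p^'p"
  shows "x \<bullet> (A *v x) \<le> real CARD('p) * norm A * (x \<bullet> x)"
proof -
  have "x \<bullet> (A *v x) = (\<Sum>k\<in>UNIV. x $ k * (A $ k \<bullet> x))"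
    by (simp add: inner_vec_def[of x] matrix_vector_mul_component)
  also have "\<dots> \<le> (\<Sum>k\<in>(UNIV :: 'p set). norm A * (x \<bullet> x))"
  proof (rule sum_mono)
    fix k
    have "\<bar>A $ k \<bullet> x\<bar> \<le> norm A * norm x"
      by (rule order_trans[OF Cauchy_Schwarz_ineq2]) (intro mult_right_mono Finite_Cartesian_Product.norm_nth_le norm_ge_zero)
    then have "\<bar>x $ k\<bar> * \<bar>A $ k \<bullet> x\<bar> \<le> norm x * (norm A * norm x)"
      by (intro mult_mono component_le_norm_cart) auto
    then have "x $ k * (A $ k \<bullet> x) \<le> norm x * (norm A * norm x)"
      by (simp add: abs_le_iff flip: abs_mult)
    then show "x $ k * (A $ k \<bullet> x) \<le> norm A * (x \<bullet> x)"
      by (simp add: dot_square_norm power2_eq_square mult_ac)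
  qed
  finally show ?thesis by simp
qed

lemma in_general_position_size_pos: "in_general_position (W :: (real^'p) multiset) \<Longrightarrow> 0 < size W"
  unfolding in_general_position_def by (metis less_le_trans zero_less_card_finite)

section \<open>Monotonicity, fixed points and bounds for the scatter equation\<close>

context weight_function
begin

text \<open>The sign of \<open>u\<close> is known at positive arguments; for \<open>z = 0\<close>
  the second factor vanishes.\<close>

lemma weight_term_nonneg:
  assumes "sym_pos_def A"
  shows "0 \<le> u (z \<bullet> (A *v z)) * (w \<bullet> z)\<^sup>2"
  using assms weight_nonneg by (cases "z = 0") (auto simp: sym_pos_def_def)

text \<open>Some point of \<open>W\<close> is not orthogonal to \<open>x\<close> and contributes a
  positive term; the other terms are non-negative.\<close>

lemma scatter_sum_sym_pos_def:
  assumes gp: "in_general_position W" and A: "sym_pos_def A"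
  shows "sym_pos_def (scatter_sum u (W + Y) A)"
  unfolding sym_pos_def_def
proof (intro conjI allI impI)
  fix x :: "real^'a" assume "x \<noteq> 0"
  then obtain z where z: "z \<in># W" "x \<bullet> z \<noteq> 0"
    using in_general_position_orthogonal_eq_0[OF gp] by blast
  have "0 < z \<bullet> (A *v z)"
    using in_general_position_nonzero[OF gp z(1)] A by (auto simp: sym_pos_def_def)
  then have "0 < u (z \<bullet> (A *v z)) * (x \<bullet> z)\<^sup>2"
    using weight_pos z(2) by simp
  also have "\<dots> \<le> (\<Sum>z\<in>#W + Y. u (z \<bullet> (A *v z)) * (x \<bullet> z)\<^sup>2)"
    using z(1) by (intro sum_mset_member_le[where f = "\<lambda>z. u (z \<bullet> (A *v z)) * (x \<bullet> z)\<^sup>2"]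
        weight_term_nonneg A) auto
  finally show "0 < x \<bullet> (scatter_sum u (W + Y) A *v x)"
    unfolding inner_scatter_sum_self
    using in_general_position_size_pos[OF gp] by (intro divide_pos_pos) auto
qed (rule scatter_sum_symmetric)

text \<open>A larger matrix has a smaller inverse, hence smaller distances and, \<open>u\<close>
  being non-increasing, larger weights.\<close>

lemma scatter_sum_mono:
  assumes V: "sym_pos_def V" and V': "sym_pos_def V'"
    and le: "\<And>x. x \<bullet> (V *v x) \<le> x \<bullet> (V' *v x)"
  shows "w \<bullet> (scatter_sum u Z (matrix_inv V) *v w) \<le> w \<bullet> (scatter_sum u Z (matrix_inv V') *v w)"
  unfolding inner_scatter_sum_self
proof (intro divide_right_mono sum_mset_mono)
  fix z
  show "u (z \<bullet> (matrix_inv V *v z)) * (w \<bullet> z)\<^sup>2 \<le> u (z \<bullet> (matrix_inv V' *v z)) * (w \<bullet> z)\<^sup>2"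
  proof (cases "z = 0")
    case False
    have "z \<bullet> (matrix_inv V' *v z) \<le> z \<bullet> (matrix_inv V *v z)"
      by (rule sym_pos_def_inverse_antimono[OF V V' le])
    moreover have "0 < z \<bullet> (matrix_inv V' *v z)"
      using sym_pos_def_inverse(3)[OF V'] False by (auto simp: sym_pos_def_def)
    moreover have "antimono_on {0<..} u"
      using weight by (simp add: scatter_weight_def)
    ultimately have "u (z \<bullet> (matrix_inv V *v z)) \<le> u (z \<bullet> (matrix_inv V' *v z))"
      by (auto simp: monotone_on_def)
    then show ?thesis by (intro mult_right_mono) auto
  qed simp
qed simp

text \<open>Test the hypothesis at \<open>w = A *v v\<close>, where the form of \<open>V\<close> is
  \<open>v \<bullet> (A *v v)\<close>, and discard the non-negative terms of
  \<open>Y\<close>.\<close>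

lemma subsolution_inverse_ineq:
  assumes V: "sym_pos_def V"
    and le: "\<And>w. w \<bullet> (scatter_sum u (W + Y) (matrix_inv V) *v w) \<le> w \<bullet> (V *v w)"
  defines "A \<equiv> matrix_inv V"
  shows "(\<Sum>x\<in>#W. u (x \<bullet> (A *v x)) * (v \<bullet> (A *v x))\<^sup>2) \<le> real (size (W + Y)) * (v \<bullet> (A *v v))"
proof (cases "W + Y = {#}")
  case False
  have A: "sym_pos_def A"
    using sym_pos_def_inverse(3)[OF V] by (simp add: A_def)
  have sym: "v \<bullet> (A *v x) = (A *v v) \<bullet> x" for x
    using A by (simp add: sym_pos_def_def inner_symmetric_matrix)
  have "(\<Sum>x\<in>#W. u (x \<bullet> (A *v x)) * ((A *v v) \<bullet> x)\<^sup>2)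
      \<le> (\<Sum>x\<in>#W + Y. u (x \<bullet> (A *v x)) * ((A *v v) \<bullet> x)\<^sup>2)"
    using sum_mset_nonneg[of Y "\<lambda>x. u (x \<bullet> (A *v x)) * ((A *v v) \<bullet> x)\<^sup>2"] weight_term_nonneg[OF A]
    by simp
  also have "\<dots> = real (size (W + Y)) * ((A *v v) \<bullet> (scatter_sum u (W + Y) A *v (A *v v)))"
  proof -
    have "real (size (W + Y)) \<noteq> 0"
      using False by (metis of_nat_eq_0_iff size_eq_0_iff_empty)
    then show ?thesis
      by (simp only: inner_scatter_sum_self times_divide_eq_right
          nonzero_mult_div_cancel_left not_False_eq_True)
  qed
  also have "\<dots> \<le> real (size (W + Y)) * ((A *v v) \<bullet> (V *v (A *v v)))"
    using le by (intro mult_left_mono) (auto simp: A_def)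
  also have "(A *v v) \<bullet> (V *v (A *v v)) = v \<bullet> (A *v v)"
    using V by (simp add: A_def inner_commute)
  finally show ?thesis by (simp add: sym)
qed simp

text \<open>\<open>V \<mapsto> scatter_sum u Z V\<inverse>\<close> is monotone for the Loewner order, so iterating it from a large
  multiple of the identity gives a decreasing sequence; every iterate is a subsolution, hence
  bounded away from singularity.\<close>

lemma scatter_sum_fixed_point:
  fixes W Y :: "(real^'p) multiset"
  assumes gp: "in_general_position W"
    and few: "real (size (W + Y)) * real CARD('p) < real (size W) * psi_sup u"
  shows "\<exists>V. sym_pos_def V \<and> V = scatter_sum u (W + Y) (matrix_inv V)"
proof -
  define Z where "Z = W + Y"
  define F where "F = (\<lambda>V. scatter_sum u Z (matrix_inv V))"
  have Z: "0 < real (size Z)"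
    using in_general_position_size_pos[OF gp] by (simp add: Z_def)
  obtain C where C': "\<forall>A. sym_pos_def A \<and> (\<forall>v. (\<Sum>x\<in>#W. u (x \<bullet> (A *v x)) * (v \<bullet> (A *v x))\<^sup>2)
      \<le> real (size (W + Y)) * (v \<bullet> (A *v v))) \<longrightarrow> norm A \<le> C"
    using inverse_scatter_bounded[OF gp of_nat_0_le_iff few] by auto
  have C: "norm (matrix_inv V) \<le> C"
    if V: "sym_pos_def V" and le: "\<And>w. w \<bullet> (F V *v w) \<le> w \<bullet> (V *v w)" for V
    using C'[rule_format, of "matrix_inv V"] sym_pos_def_inverse(3)[OF V]
      subsolution_inverse_ineq[OF V le[unfolded F_def Z_def]] by blast
  obtain B where B: "B > 0" "\<And>s. 0 \<le> s \<Longrightarrow> \<bar>u s\<bar> \<le> B"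
    using weight_bounded by blast
  \<comment> \<open>Chosen so that \<open>F V0\<close> lies below \<open>V0\<close> whatever weights
    occur; the summand 1 secures positivity.\<close>
  define c where "c = (\<Sum>z\<in>#Z. B * (z \<bullet> z)) / real (size Z) + 1"
  have c: "c > 0"
    using B(1) Z sum_mset_nonneg[of Z "\<lambda>z. B * (z \<bullet> z)"] by (simp add: c_def add_nonneg_pos)
  define V0 :: "real^'p^'p" where "V0 = c *\<^sub>R mat 1"
  have V0: "V0 *v x = c *\<^sub>R x" for x
    by (simp add: V0_def flip: scaleR_matrix_vector_assoc)
  have V0_spd: "sym_pos_def V0"
    using c by (simp add: sym_pos_def_def V0) (simp add: V0_def transpose_scalar)
  have F_spd: "sym_pos_def (F V)" if "sym_pos_def V" for V
    unfolding F_def Z_def by (intro scatter_sum_sym_pos_def gp sym_pos_def_inverse(3) that)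
  have F_V0: "w \<bullet> (F V0 *v w) \<le> w \<bullet> (V0 *v w)" for w
  proof -
    have "(\<Sum>z\<in>#Z. u (z \<bullet> (matrix_inv V0 *v z)) * (w \<bullet> z)\<^sup>2) \<le> (\<Sum>z\<in>#Z. (w \<bullet> w) * (B * (z \<bullet> z)))"
    proof (rule sum_mset_mono)
      fix z
      have "0 \<le> z \<bullet> (matrix_inv V0 *v z)"
        using sym_pos_def_imp_pos_semidef[OF sym_pos_def_inverse(3)[OF V0_spd]]
        by (simp add: pos_semidef_def)
      then have "u (z \<bullet> (matrix_inv V0 *v z)) \<le> B"
        using B(2) abs_le_D1 by blast
      then have "u (z \<bullet> (matrix_inv V0 *v z)) * (w \<bullet> z)\<^sup>2 \<le> B * ((w \<bullet> w) * (z \<bullet> z))"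
        using B(1) by (intro mult_mono Cauchy_Schwarz_ineq) auto
      then show "u (z \<bullet> (matrix_inv V0 *v z)) * (w \<bullet> z)\<^sup>2 \<le> (w \<bullet> w) * (B * (z \<bullet> z))"
        by (simp add: mult_ac)
    qed
    then have "w \<bullet> (F V0 *v w) \<le> (w \<bullet> w) * (\<Sum>z\<in>#Z. B * (z \<bullet> z)) / real (size Z)"
      unfolding F_def inner_scatter_sum_self
      by (intro divide_right_mono) (simp_all add: sum_mset_distrib_left)
    also have "\<dots> \<le> c * (w \<bullet> w)"
      by (simp add: c_def algebra_simps)
    finally show ?thesis by (simp add: V0)
  qed
  define V where "V = (\<lambda>k. (F ^^ k) V0)"
  have VS: "V (Suc k) = F (V k)" for k by (simp add: V_def)
  have spd: "sym_pos_def (V k)" for k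
    by (induction k) (simp_all add: VS F_spd, simp add: V_def V0_spd)
  define A where "A = (\<lambda>k. matrix_inv (V k))"
  have A_spd: "sym_pos_def (A k)" for k
    using sym_pos_def_inverse(3)[OF spd] by (simp add: A_def)
  have dec: "w \<bullet> (V (Suc k) *v w) \<le> w \<bullet> (V k *v w)" for k w
  proof (induction k arbitrary: w)
    case 0
    then show ?case using F_V0 by (simp add: V_def)
  next
    case (Suc k)
    have "w \<bullet> (F (V (Suc k)) *v w) \<le> w \<bullet> (F (V k) *v w)"
      unfolding F_def by (rule scatter_sum_mono[OF spd spd Suc.IH])
    then show ?case by (simp add: VS)
  qed
  have inc: "w \<bullet> (A k *v w) \<le> w \<bullet> (A (Suc k) *v w)" for k w
    unfolding A_def by (rule sym_pos_def_inverse_antimono[OF spd spd dec])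
  have A_le: "w \<bullet> (A k *v w) \<le> real CARD('p) * C * (w \<bullet> w)" for k w
  proof -
    \<comment> \<open>\<open>dec\<close> says precisely that \<open>V k\<close> is a
      subsolution.\<close>
    have "norm (A k) \<le> C"
      unfolding A_def using dec by (intro C spd) (simp add: VS)
    then have "real CARD('p) * norm (A k) * (w \<bullet> w) \<le> real CARD('p) * C * (w \<bullet> w)"
      by (intro mult_right_mono mult_left_mono) auto
    then show ?thesis using quadratic_form_le_norm order_trans by blast
  qed
  have psd: "pos_semidef (V k)" "pos_semidef (A k)" for k
    by (intro sym_pos_def_imp_pos_semidef spd A_spd)+
  have "convergent V"
  proof (rule convergent_quadratic_forms_imp_convergent)
    show "convergent (\<lambda>k. x \<bullet> (V k *v x))" for x
    proof -
      have "decseq (\<lambda>k. x \<bullet> (V k *v x))" "\<And>k. 0 \<le> x \<bullet> (V k *v x)"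
        using dec psd by (auto simp: decseq_Suc_iff pos_semidef_def)
      then show ?thesis
        by (metis decseq_convergent convergentI)
    qed
  qed (use psd in \<open>simp add: pos_semidef_def\<close>)
  then obtain L where L: "V \<longlonglongrightarrow> L" by (auto simp: convergent_def)
  have "convergent A"
  proof (rule convergent_quadratic_forms_imp_convergent)
    show "convergent (\<lambda>k. x \<bullet> (A k *v x))" for x
    proof -
      have "incseq (\<lambda>k. x \<bullet> (A k *v x))"
        using inc by (simp add: incseq_Suc_iff)
      then show ?thesis
        using A_le by (metis incseq_convergent convergentI)
    qed
  qed (use psd in \<open>simp add: pos_semidef_def\<close>)
  then obtain M where M: "A \<longlonglongrightarrow> M" by (auto simp: convergent_def)
  \<comment> \<open>Since the inverses converge too, the limit of the products is the identity and
    \<open>L\<close> cannot be singular.\<close>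
  have "(\<lambda>k. V k ** A k) \<longlonglongrightarrow> L ** M"
    by (rule tendsto_matrix_mult[OF L M])
  then have LM: "L ** M = mat 1"
    unfolding A_def sym_pos_def_inverse(1)[OF spd] by (simp add: LIMSEQ_const_iff)
  then have LM_swap: "M ** L = mat 1"
    by (simp add: matrix_left_right_inverse)
  have psd_lim: "pos_semidef L" "pos_semidef M"
    using pos_semidef_LIMSEQ L M psd by blast+
  have pos: "0 < x \<bullet> (P *v x)" if "pos_semidef P" "Q ** P = mat 1" "x \<noteq> 0" for P Q :: "real^'p^'p" and x
  proof -
    have "P *v x \<noteq> 0"
      using that by (metis matrix_vector_mul_assoc matrix_vector_mul_lid matrix_vector_mult_0_right)
    then show ?thesis
      using that(1) pos_semidef_quadratic_form_eq_0[OF that(1)]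
      by (metis less_eq_real_def pos_semidef_def)
  qed
  have L_spd: "sym_pos_def L"
    using psd_lim pos[OF psd_lim(1) LM_swap] by (simp add: sym_pos_def_def pos_semidef_def)
  have L_inv: "matrix_inv L = M"
    by (rule matrix_inv_unique[OF L_spd LM])
  \<comment> \<open>Continuity of \<open>u\<close> is available at positive arguments; for
    \<open>z = 0\<close> the outer product vanishes.\<close>
  have term_lim: "(\<lambda>k. u (z \<bullet> (A k *v z)) *\<^sub>R outer_self z) \<longlonglongrightarrow> u (z \<bullet> (M *v z)) *\<^sub>R outer_self z" for z
  proof (cases "z = 0")
    case False
    have "0 < z \<bullet> (M *v z)" by (rule pos[OF psd_lim(2) LM False])
    moreover have "continuous_on {0<..} u"
      using weight by (simp add: scatter_weight_def)
    ultimately have "isCont u (z \<bullet> (M *v z))"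
      by (simp add: continuous_on_eq_continuous_at)
    then show ?thesis
      by (intro tendsto_intros isCont_tendsto_compose[where g = u] M)
  qed simp
  have "(\<lambda>k. F (V k)) \<longlonglongrightarrow> scatter_sum u Z M"
    unfolding F_def scatter_sum_def
    by (intro tendsto_scaleR tendsto_const tendsto_sum_mset term_lim[unfolded A_def])
  moreover have "(\<lambda>k. F (V k)) \<longlonglongrightarrow> L"
    using LIMSEQ_Suc[OF L] by (simp add: VS)
  ultimately have "L = scatter_sum u Z M"
    using LIMSEQ_unique by blast
  with L_spd L_inv show ?thesis by (auto simp: Z_def)
qed

text \<open>In N w'Vw a data point x contributes at most B |x|^2 |w|^2. By dual Cauchy-Schwarz a
  contaminating point contributes at most u(s) s w'Vw, hence at most K w'Vw. Moving the latter to
  the left leaves the positive factor N - m K.\<close>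

lemma scatter_sum_upper_bound:
  fixes W Y :: "(real^'p) multiset"
  assumes V: "sym_pos_def V" "V = scatter_sum u (W + Y) (matrix_inv V)"
    and B: "\<And>s. 0 \<le> s \<Longrightarrow> \<bar>u s\<bar> \<le> B"
    and few: "real (size Y) * psi_sup u < real (size (W + Y))"
  shows "w \<bullet> (V *v w)
    \<le> (\<Sum>x\<in>#W. B * (x \<bullet> x)) / (real (size (W + Y)) - real (size Y) * psi_sup u) * (w \<bullet> w)"
proof -
  define A where "A = matrix_inv V"
  define N where "N = real (size (W + Y))"
  have A: "sym_pos_def A"
    using sym_pos_def_inverse(3)[OF V(1)] by (simp add: A_def)
  have s: "0 \<le> z \<bullet> (A *v z)" for z
    using sym_pos_def_imp_pos_semidef[OF A] by (simp add: pos_semidef_def)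
  have Vw: "0 \<le> w \<bullet> (V *v w)"
    using sym_pos_def_imp_pos_semidef[OF V(1)] by (simp add: pos_semidef_def)
  have B0: "0 \<le> B" using B[of 0] by simp
  have "N > 0"
    using few psi_sup_pos unfolding N_def by (meson le_less_trans mult_nonneg_nonneg of_nat_0_le_iff less_imp_le)
  have "w \<bullet> (V *v w) = (\<Sum>z\<in>#W + Y. u (z \<bullet> (A *v z)) * (w \<bullet> z)\<^sup>2) / N"
    by (subst V(2)) (simp only: inner_scatter_sum_self A_def N_def)
  then have "N * (w \<bullet> (V *v w)) = (\<Sum>z\<in>#W. u (z \<bullet> (A *v z)) * (w \<bullet> z)\<^sup>2)
      + (\<Sum>z\<in>#Y. u (z \<bullet> (A *v z)) * (w \<bullet> z)\<^sup>2)"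
    using \<open>N > 0\<close> by simp
  also have "(\<Sum>z\<in>#W. u (z \<bullet> (A *v z)) * (w \<bullet> z)\<^sup>2) \<le> (\<Sum>z\<in>#W. (w \<bullet> w) * (B * (z \<bullet> z)))"
  proof (rule sum_mset_mono)
    fix z
    have "u (z \<bullet> (A *v z)) \<le> B" using B[OF s] abs_le_D1 by blast
    then have "u (z \<bullet> (A *v z)) * (w \<bullet> z)\<^sup>2 \<le> B * ((w \<bullet> w) * (z \<bullet> z))"
      using B0 by (intro mult_mono Cauchy_Schwarz_ineq) auto
    then show "u (z \<bullet> (A *v z)) * (w \<bullet> z)\<^sup>2 \<le> (w \<bullet> w) * (B * (z \<bullet> z))"
      by (simp add: mult_ac)
  qed
  also have "(\<Sum>z\<in>#Y. u (z \<bullet> (A *v z)) * (w \<bullet> z)\<^sup>2) \<le> (\<Sum>z\<in>#Y. psi_sup u * (w \<bullet> (V *v w)))"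
  proof (rule sum_mset_mono)
    fix z
    show "u (z \<bullet> (A *v z)) * (w \<bullet> z)\<^sup>2 \<le> psi_sup u * (w \<bullet> (V *v w))"
    proof (cases "z = 0")
      case False
      then have pos: "0 < z \<bullet> (A *v z)" using A by (auto simp: sym_pos_def_def)
      have "u (z \<bullet> (A *v z)) * (w \<bullet> z)\<^sup>2 \<le> u (z \<bullet> (A *v z)) * ((w \<bullet> (V *v w)) * (z \<bullet> (A *v z)))"
        using weight_nonneg[OF pos] sym_pos_def_dual_Cauchy_Schwarz[OF V(1)]
        by (intro mult_left_mono) (auto simp: A_def)
      also have "\<dots> = psi u (z \<bullet> (A *v z)) * (w \<bullet> (V *v w))"
        by (simp add: psi_def)
      also have "\<dots> \<le> psi_sup u * (w \<bullet> (V *v w))"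
        by (intro mult_right_mono psi_le_psi_sup s Vw)
      finally show ?thesis .
    qed (use psi_sup_pos Vw in simp)
  qed
  finally have "N * (w \<bullet> (V *v w)) \<le> (w \<bullet> w) * (\<Sum>x\<in>#W. B * (x \<bullet> x))
      + real (size Y) * psi_sup u * (w \<bullet> (V *v w))"
    by (simp add: sum_mset_distrib_left mult.assoc)
  then have "(N - real (size Y) * psi_sup u) * (w \<bullet> (V *v w)) \<le> (\<Sum>x\<in>#W. B * (x \<bullet> x)) * (w \<bullet> w)"
    by (simp add: algebra_simps)
  then show ?thesis
    using few by (simp add: N_def pos_le_divide_eq mult.commute)
qed

end

subsection \<open>Breakdown\<close>

lemma is_scatter_scatter: "scatter_exists u t Z \<Longrightarrow> is_scatter u t Z (scatter u t Z)"
  unfolding scatter_exists_def scatter_def by (rule someI_ex)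

context weight_function
begin

lemma scatter_exists_if:
  assumes "in_general_position (image_mset (\<lambda>x. x - t) X)"
    and "real (size (X + Y)) * real CARD('p) < real (size X) * psi_sup u"
  shows "scatter_exists u (t :: real^'p) (X + Y)"
  using scatter_sum_fixed_point[OF assms(1), of "image_mset (\<lambda>x. x - t) Y"] assms(2)
  by (auto simp: scatter_exists_def is_scatter_iff_scatter_sum)

text \<open>The two conditions bound the entries of the inverse and of the estimate itself; the
  trace is linear in these entries, with coefficients from the fixed \<open>V0\<close>.\<close>

lemma max_bias_less_infinity:
  fixes X :: "(real^'p) multiset"
  assumes gp: "in_general_position (image_mset (\<lambda>x. x - t) X)"
    and few_inner: "real (size X + m) * real CARD('p) < real (size X) * psi_sup u"
    and few_outer: "real m * psi_sup u < real (size X + m)"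
  shows "max_bias u t X m < \<infinity>"
proof -
  define W where "W = image_mset (\<lambda>x. x - t) X"
  define N where "N = real (size X + m)"
  have gpW: "in_general_position W" using gp by (simp add: W_def)
  have ex: "scatter_exists u t (X + Y)" if "size Y = m" for Y
    using scatter_exists_if[OF gp, of Y] few_inner that by simp
  obtain B where B: "\<And>s. 0 \<le> s \<Longrightarrow> \<bar>u s\<bar> \<le> B"
    using weight_bounded by blast
  define C where "C = (\<Sum>x\<in>#W. B * (x \<bullet> x)) / (N - real m * psi_sup u)"
  have "N * real CARD('p) < real (size W) * psi_sup u" "0 \<le> N"
    using few_inner by (simp_all add: N_def W_def)
  then obtain C' where C': "\<forall>A. sym_pos_def A \<and> (\<forall>v. (\<Sum>x\<in>#W. u (x \<bullet> (A *v x)) * (v \<bullet> (A *v x))\<^sup>2)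
      \<le> N * (v \<bullet> (A *v v))) \<longrightarrow> norm A \<le> C'"
    using inverse_scatter_bounded[OF gpW] by blast
  define V0 where "V0 = scatter u t X"
  \<comment> \<open>\<open>C\<close>, \<open>C'\<close> and \<open>D\<close> depend on the data and
    on \<open>m\<close>, not on the position of the contamination.\<close>
  define D where "D = (\<Sum>i\<in>UNIV. \<Sum>j\<in>UNIV. C * \<bar>matrix_inv V0 $ j $ i\<bar> + \<bar>V0 $ i $ j\<bar> * C')"
  have "trace (scatter u t (X + Y) ** matrix_inv V0 + V0 ** matrix_inv (scatter u t (X + Y))) \<le> D"
    if Y: "size Y = m" for Y
  proof -
    define V where "V = scatter u t (X + Y)"
    define U where "U = image_mset (\<lambda>x. x - t) Y"
    have V: "sym_pos_def V" "V = scatter_sum u (W + U) (matrix_inv V)"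
      using is_scatter_scatter[OF ex[OF Y]]
      by (auto simp: is_scatter_iff_scatter_sum V_def W_def U_def)
    have size: "real (size (W + U)) = N" "size U = m"
      using Y by (simp_all add: W_def U_def N_def)
    have "w \<bullet> (V *v w) \<le> C * (w \<bullet> w)" for w
      using scatter_sum_upper_bound[OF V B, of w] few_outer
      unfolding size C_def by (simp add: N_def)
    then have VC: "\<bar>V $ i $ j\<bar> \<le> C" for i j
      by (intro pos_semidef_abs_component_le sym_pos_def_imp_pos_semidef V)
    have "w \<bullet> (scatter_sum u (W + U) (matrix_inv V) *v w) \<le> w \<bullet> (V *v w)" for w
      by (simp flip: V(2))
    from subsolution_inverse_ineq[OF V(1) this, unfolded size]
    have "norm (matrix_inv V) \<le> C'"
      using C' sym_pos_def_inverse(3)[OF V(1)] by blast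
    then have AC: "\<bar>matrix_inv V $ i $ j\<bar> \<le> C'" for i j
      by (rule order_trans[OF component_le_norm_cart
            order_trans[OF Finite_Cartesian_Product.norm_nth_le]])
    have "trace (V ** matrix_inv V0 + V0 ** matrix_inv V)
        = (\<Sum>i\<in>UNIV. \<Sum>j\<in>UNIV. V $ i $ j * matrix_inv V0 $ j $ i + V0 $ i $ j * matrix_inv V $ j $ i)"
      by (simp add: trace_def matrix_matrix_mult_def sum.distrib)
    also have "\<dots> \<le> D"
      unfolding D_def
    proof (intro sum_mono add_mono)
      fix i j
      show "V $ i $ j * matrix_inv V0 $ j $ i \<le> C * \<bar>matrix_inv V0 $ j $ i\<bar>"
        by (rule order_trans[OF abs_ge_self]) (auto simp: abs_mult intro!: mult_right_mono VC)
      show "V0 $ i $ j * matrix_inv V $ j $ i \<le> \<bar>V0 $ i $ j\<bar> * C'"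
        by (rule order_trans[OF abs_ge_self]) (auto simp: abs_mult intro!: mult_left_mono AC)
    qed
    finally show ?thesis by (simp add: V_def)
  qed
  then have "max_bias u t X m \<le> ereal D"
    using ex unfolding max_bias_def V0_def by (auto intro!: SUP_least)
  then show ?thesis
    by (rule le_less_trans) simp
qed

text \<open>Multiplying the equation by the inverse and taking traces gives N p as a sum of values
  of \<open>psi\<close>. Points at the centre contribute 0, so N p would be at most n K.\<close>

lemma not_scatter_exists_replicate_center:
  fixes X :: "(real^'p) multiset"
  assumes many: "real (size X) * psi_sup u < real (size X + m) * real CARD('p)"
  shows "\<not> scatter_exists u t (X + replicate_mset m t)"
proof
  assume "scatter_exists u t (X + replicate_mset m t)"
  define W where "W = image_mset (\<lambda>x. x - t) X"
  define Z where "Z = W + replicate_mset m 0"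
  obtain V where V: "sym_pos_def V" "V = scatter_sum u Z (matrix_inv V)"
    using \<open>scatter_exists u t (X + replicate_mset m t)\<close>
    by (auto simp: scatter_exists_def is_scatter_iff_scatter_sum W_def Z_def)
  define A where "A = matrix_inv V"
  have nonneg: "0 \<le> z \<bullet> (A *v z)" for z
    using sym_pos_def_imp_pos_semidef[OF sym_pos_def_inverse(3)[OF V(1)]]
    by (simp add: pos_semidef_def A_def)
  have N: "0 < real (size Z)"
  proof (rule ccontr)
    assume "\<not> 0 < real (size Z)"
    then have "size Z = 0" by linarith
    then have "X = {#}" "m = 0" by (simp_all add: Z_def W_def)
    then show False using many by simp
  qed
  have "real CARD('p) = trace (V ** A)"
    using sym_pos_def_inverse(1)[OF V(1)] by (simp add: A_def trace_def mat_def)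
  also have "\<dots> = (\<Sum>z\<in>#Z. psi u (z \<bullet> (A *v z))) / real (size Z)"
    by (subst V(2)) (simp add: trace_scatter_sum_mult A_def psi_def mult.commute)
  finally have "real (size Z) * real CARD('p) = (\<Sum>z\<in>#Z. psi u (z \<bullet> (A *v z)))"
    using N by (simp add: field_simps)
  also have "\<dots> = (\<Sum>z\<in>#W. psi u (z \<bullet> (A *v z)))"
    by (simp add: Z_def psi_def)
  also have "\<dots> \<le> (\<Sum>z\<in>#W. psi_sup u)"
    by (intro sum_mset_mono psi_le_psi_sup nonneg)
  finally show False
    using many by (simp add: Z_def W_def)
qed

text \<open>All contaminating points are placed at \<open>r x\<close> for a single data point \<open>x\<close>, \<open>r\<close> large.  If the
  bias stayed bounded, \<open>s = x'V\<inverse>x\<close> would be bounded below; testing the defining equation with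
  \<open>V\<inverse>x\<close> gives \<open>psi u s + m psi u (r\<^sup>2 s) \<le> n + m\<close>, which fails as \<open>r \<rightarrow> \<infinity>\<close>.\<close>

lemma max_bias_eq_infinity:
  fixes X :: "(real^'p) multiset"
  assumes gp: "in_general_position (image_mset (\<lambda>x. x - t) X)"
    and K: "real CARD('p) < psi_sup u" and "1 \<le> m"
    and many: "real (size X + m) \<le> real m * psi_sup u"
  shows "max_bias u t X m = \<infinity>"
proof (rule ccontr)
  assume "max_bias u t X m \<noteq> \<infinity>"
  define W where "W = image_mset (\<lambda>x. x - t) X"
  define N where "N = real (size X + m)"
  have gpW: "in_general_position W" using gp by (simp add: W_def)
  have size_pos: "0 < real (size X)"
    using in_general_position_size_pos[OF gp] by simp
  have ex: "\<And>Y. size Y = m \<Longrightarrow> scatter_exists u t (X + Y)"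
    and sup: "max_bias u t X m = (SUP Y\<in>{Y. size Y = m}.
        ereal (trace (scatter u t (X + Y) ** matrix_inv (scatter u t X) +
                      scatter u t X ** matrix_inv (scatter u t (X + Y)))))"
    using \<open>max_bias u t X m \<noteq> \<infinity>\<close> unfolding max_bias_def by (auto split: if_splits)
  obtain b :: real where b: "max_bias u t X m \<le> ereal b"
    using \<open>max_bias u t X m \<noteq> \<infinity>\<close> by (cases "max_bias u t X m") auto
  define V0 where "V0 = scatter u t X"
  \<comment> \<open>Without contamination the existence criterion reduces to p < K.\<close>
  have "scatter_exists u t (X + {#})"
    using K size_pos by (intro scatter_exists_if gp) simp
  then have V0: "sym_pos_def V0" "V0 = scatter_sum u W (matrix_inv V0)"
    using is_scatter_scatter[of u t X] by (simp_all add: is_scatter_iff_scatter_sum V0_def W_def)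
  obtain x where x: "x \<in># W"
    using in_general_position_size_pos[OF gpW] by (metis multiset_nonemptyE nonempty_has_size)
  have "x \<noteq> 0" by (rule in_general_position_nonzero[OF gpW x])
  define q where "q = x \<bullet> (V0 *v x)"
  have q: "0 < q" using V0(1) \<open>x \<noteq> 0\<close> by (simp add: q_def sym_pos_def_def)
  have key: "(x \<bullet> x)\<^sup>2 \<le> q * b * s \<and> 0 < s \<and> psi u s + real m * psi u (r\<^sup>2 * s) \<le> N"
    if "s = x \<bullet> (matrix_inv (scatter u t (X + replicate_mset m (t + r *\<^sub>R x))) *v x)" for r s
  proof -
    define Y where "Y = replicate_mset m (t + r *\<^sub>R x)"
    define V where "V = scatter u t (X + Y)"
    define Z where "Z = W + replicate_mset m (r *\<^sub>R x)"
    define A where "A = matrix_inv V"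
    have s: "s = x \<bullet> (A *v x)" using that by (simp add: A_def V_def Y_def)
    have sizeY: "size Y = m" by (simp add: Y_def)
    have V: "sym_pos_def V" "V = scatter_sum u Z A"
      using is_scatter_scatter[OF ex[OF sizeY]]
      by (simp_all add: is_scatter_iff_scatter_sum V_def W_def Y_def Z_def A_def)
    have A: "sym_pos_def A" using sym_pos_def_inverse(3)[OF V(1)] by (simp add: A_def)
    have sizeZ: "real (size Z) = N" "0 < N"
      using \<open>1 \<le> m\<close> by (simp_all add: Z_def W_def N_def)
    have "0 < s" using A \<open>x \<noteq> 0\<close> by (simp add: s sym_pos_def_def)
    have "ereal (trace (V ** matrix_inv V0 + V0 ** A)) \<le> max_bias u t X m"
      unfolding sup using sizeY by (intro SUP_upper2[of Y]) (auto simp: V_def V0_def A_def)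
    then have "trace (V ** matrix_inv V0) + trace (V0 ** A) \<le> b"
      using b by (metis order_trans ereal_less_eq(3) trace_add)
    \<comment> \<open>Both traces are non-negative, so a bound on the sum bounds each of them; only
      this sign is used here.\<close>
    moreover have "0 \<le> trace (V0 ** A)"
    proof -
      have "0 \<le> (\<Sum>z\<in>#W. u (z \<bullet> (matrix_inv V0 *v z)) * (z \<bullet> (A *v z)))"
      proof (rule sum_mset_nonneg)
        fix z assume "z \<in># W"
        then have "z \<noteq> 0" by (rule in_general_position_nonzero[OF gpW])
        then have "0 < z \<bullet> (matrix_inv V0 *v z)" "0 < z \<bullet> (A *v z)"
          using A sym_pos_def_inverse(3)[OF V0(1)] by (auto simp: sym_pos_def_def)
        then show "0 \<le> u (z \<bullet> (matrix_inv V0 *v z)) * (z \<bullet> (A *v z))"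
          using weight_nonneg by simp
      qed
      then show ?thesis
        by (subst V0(2)) (simp add: trace_scatter_sum_mult)
    qed
    ultimately have tr: "trace (V ** matrix_inv V0) \<le> b" by linarith
    have "x \<bullet> (V *v x) = (\<Sum>z\<in>#Z. u (z \<bullet> (A *v z)) * (x \<bullet> z)\<^sup>2) / N"
      by (subst V(2)) (simp only: inner_scatter_sum_self sizeZ)
    \<comment> \<open>Dual Cauchy-Schwarz for \<open>V0\<close> turns x'Vx into \<open>q\<close>
      times the trace controlled by the bias.\<close>
    also have "\<dots> \<le> (\<Sum>z\<in>#Z. q * (u (z \<bullet> (A *v z)) * (z \<bullet> (matrix_inv V0 *v z)))) / N"
    proof (intro divide_right_mono sum_mset_mono)
      fix z
      show "u (z \<bullet> (A *v z)) * (x \<bullet> z)\<^sup>2 \<le> q * (u (z \<bullet> (A *v z)) * (z \<bullet> (matrix_inv V0 *v z)))"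
      proof (cases "z = 0")
        case False
        then have "0 \<le> u (z \<bullet> (A *v z))"
          using A weight_nonneg by (simp add: sym_pos_def_def)
        then have "u (z \<bullet> (A *v z)) * (x \<bullet> z)\<^sup>2 \<le> u (z \<bullet> (A *v z)) * (q * (z \<bullet> (matrix_inv V0 *v z)))"
          unfolding q_def by (intro mult_left_mono sym_pos_def_dual_Cauchy_Schwarz V0)
        then show ?thesis by (simp add: mult_ac)
      qed simp
    qed (use sizeZ in simp)
    also have "\<dots> = q * trace (scatter_sum u Z A ** matrix_inv V0)"
      by (simp only: trace_scatter_sum_mult sizeZ times_divide_eq_right flip: sum_mset_distrib_left)
    also have "\<dots> \<le> q * b"
      using tr q V(2) by simp
    finally have xVx: "x \<bullet> (V *v x) \<le> q * b" .
    have "(x \<bullet> x)\<^sup>2 \<le> (x \<bullet> (V *v x)) * s"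
      unfolding s A_def by (rule sym_pos_def_dual_Cauchy_Schwarz[OF V(1)])
    also have "\<dots> \<le> q * b * s"
      using xVx \<open>0 < s\<close> by (intro mult_right_mono) auto
    finally have lower: "(x \<bullet> x)\<^sup>2 \<le> q * b * s" .
    define f where "f = (\<lambda>z. u (z \<bullet> (A *v z)) * ((A *v x) \<bullet> z)\<^sup>2)"
    have Axx: "(A *v x) \<bullet> x = s" by (simp add: s inner_commute)
    have "s = (A *v x) \<bullet> (V *v (A *v x))"
      using V(1) by (simp add: s A_def inner_commute)
    also have "\<dots> = (\<Sum>z\<in>#Z. f z) / N"
      by (subst V(2)) (simp only: inner_scatter_sum_self sizeZ f_def)
    finally have "N * s = (\<Sum>z\<in>#W. f z) + real m * f (r *\<^sub>R x)"
      using sizeZ by (simp add: Z_def field_simps)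
    \<comment> \<open>Of the data terms only the one at \<open>x\<close> is kept.\<close>
    also have "\<dots> \<ge> f x + real m * f (r *\<^sub>R x)"
      using sum_mset_member_le[of W f x] x weight_term_nonneg[OF A] by (simp add: f_def)
    finally have "f x + real m * f (r *\<^sub>R x) \<le> N * s" .
    moreover have "f x = s * psi u s"
      by (simp add: f_def Axx psi_def power2_eq_square flip: s)
    moreover have "f (r *\<^sub>R x) = s * psi u (r\<^sup>2 * s)"
      by (simp add: f_def Axx psi_def power2_eq_square matrix_vector_mult_scaleR mult_ac flip: s)
    ultimately have "s * (psi u s + real m * psi u (r\<^sup>2 * s)) \<le> s * N"
      by (simp add: algebra_simps)
    then show ?thesis using lower \<open>0 < s\<close> by simp
  qed
  have xx: "0 < (x \<bullet> x)\<^sup>2" using \<open>x \<noteq> 0\<close> by simp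
  have qb: "0 < q * b"
  proof -
    \<comment> \<open>Any instance would do; \<open>r = 0\<close> puts the contamination at the
      centre.\<close>
    obtain s where "(x \<bullet> x)\<^sup>2 \<le> q * b * s" "0 < s"
      using key[OF refl, of 0] by blast
    then show ?thesis using xx by (smt (verit) mult_nonpos_nonneg)
  qed
  \<comment> \<open>A lower bound for \<open>s\<close> that is uniform in \<open>r\<close>.\<close>
  define s0 where "s0 = (x \<bullet> x)\<^sup>2 / (q * b)"
  have s0: "0 < s0" using xx qb by (simp add: s0_def)
  have bound: "psi u s0 + real m * psi u s' \<le> N" if "0 < s'" for s'
  proof -
    \<comment> \<open>With this \<open>r\<close>, r^2 s is at least \<open>s'\<close> for every s
      \<ge> \<open>s0\<close>.\<close>
    define r where "r = sqrt (s' / s0)"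
    have r: "r\<^sup>2 * s0 = s'" using s0 that by (simp add: r_def)
    obtain s where s: "(x \<bullet> x)\<^sup>2 \<le> q * b * s" "psi u s + real m * psi u (r\<^sup>2 * s) \<le> N"
      using key[OF refl, of r] by blast
    have "s0 \<le> s"
      using s(1) qb by (simp add: s0_def pos_divide_le_eq mult.commute)
    then have "psi u s0 \<le> psi u s" "psi u s' \<le> psi u (r\<^sup>2 * s)"
      using s0 that r by (auto intro!: psi_mono mult_left_mono)
    then show ?thesis
      using s(2) mult_left_mono[of "psi u s'" "psi u (r\<^sup>2 * s)" "real m"] by simp
  qed
  have "psi u s0 + real m * psi_sup u \<le> N"
  proof (rule tendsto_upperbound)
    show "((\<lambda>s. psi u s0 + real m * psi u s) \<longlongrightarrow> psi u s0 + real m * psi_sup u) at_top"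
      by (intro tendsto_intros psi_tendsto_psi_sup)
    show "\<forall>\<^sub>F s in at_top. psi u s0 + real m * psi u s \<le> N"
      using eventually_gt_at_top[of 0] by eventually_elim (rule bound)
  qed simp
  \<comment> \<open>Strict positivity of \<open>psi u s0\<close> also excludes equality in
    \<open>many\<close>.\<close>
  then show False
    using many psi_pos[OF s0] by (simp add: N_def)
qed

end

text \<open>With N = n + m, a fraction below 1/K means m K < N, and one below 1 - p/K means N p < n
  K: these are the two conditions for bounded bias. Beyond either threshold one of the two special
  contaminations causes breakdown.\<close>

theorem theorem3p1:
  fixes u :: "real \<Rightarrow> real" and t :: "real^'p" and X :: "(real^'p) multiset"
  assumes "scatter_weight u"
    and "psi_sup u > real CARD('p)"
    and "general_position_about t X"
    and "size X > CARD('p) * (CARD('p) - 1)"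
  shows "(real (size X) + 1 > psi_sup u \<longrightarrow>
            is_breakdown_fraction u t X
              (min (1 / psi_sup u) (1 - real CARD('p) / psi_sup u))) \<and>
         (real (size X) + 1 \<le> psi_sup u \<longrightarrow> is_breakdown_fraction u t X 0)"
proof -
  define K where "K = psi_sup u"
  define p where "p = CARD('p)"
  define n where "n = size X"
  have K: "real p < K" using assms(2) by (simp add: K_def p_def)
  have p: "1 \<le> p" by (simp add: p_def Suc_le_eq)
  interpret weight_function u
    using assms(1) K by unfold_locales (simp_all add: K_def[symmetric])
  \<comment> \<open>For p = 1 the size assumption says n > 0; for p \<ge> 2, p (p - 1) is at least
    p.\<close>
  have np: "p \<le> n"
  proof (cases "p = 1")
    case True
    then show ?thesis using assms(4) by (simp add: p_def n_def)
  next
    case False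
    with p have "p \<le> p * (p - 1)" by (simp add: Suc_le_eq)
    moreover have "p * (p - 1) < n" using assms(4) unfolding p_def n_def .
    ultimately show ?thesis by linarith
  qed
  have gp: "in_general_position (image_mset (\<lambda>x. x - t) X)"
    using assms(3) np by (intro general_position_about_imp_in_general_position) (simp_all add: p_def n_def)
  have K0: "0 < K" using K by simp
  \<comment> \<open>The threshold itself is included: for n + 1 = K a single contaminating point has
    fraction exactly 1/K.\<close>
  have infinite: "max_bias u t X m = \<infinity>" if "1 \<le> m" "1 / K \<le> contam_fraction X m" for m
  proof (rule max_bias_eq_infinity[OF gp assms(2) that(1)])
    show "real (size X + m) \<le> real m * psi_sup u"
      using that K0 by (simp add: contam_fraction_def K_def field_simps)
  qed
  have infinite': "max_bias u t X m = \<infinity>" if "1 \<le> m" "1 - real p / K < contam_fraction X m" for m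
  proof -
    have "real (size X) * psi_sup u < real (size X + m) * real CARD('p)"
      using that K0 by (simp add: contam_fraction_def K_def p_def field_simps)
    then have "\<not> scatter_exists u t (X + replicate_mset m t)"
      by (rule not_scatter_exists_replicate_center)
    then show ?thesis
      unfolding max_bias_def by (auto intro: exI[of _ "replicate_mset m t"])
  qed
  have finite: "max_bias u t X m < \<infinity>"
    if "1 \<le> m" "contam_fraction X m < 1 / K" "contam_fraction X m < 1 - real p / K" for m
  proof (rule max_bias_less_infinity[OF gp])
    show "real (size X + m) * real CARD('p) < real (size X) * psi_sup u"
      using that K0 by (simp add: contam_fraction_def K_def p_def field_simps)
    show "real m * psi_sup u < real (size X + m)"
      using that K0 by (simp add: contam_fraction_def K_def field_simps)
  qed
  have "is_breakdown_fraction u t X (min (1 / K) (1 - real p / K))"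
    unfolding is_breakdown_fraction_def
  proof (intro allI impI conjI)
    fix m :: nat assume "1 \<le> m"
    show "max_bias u t X m = \<infinity>" if "min (1 / K) (1 - real p / K) < contam_fraction X m"
      using that infinite[OF \<open>1 \<le> m\<close>] infinite'[OF \<open>1 \<le> m\<close>]
      unfolding min_less_iff_disj by (blast intro: less_imp_le)
    show "max_bias u t X m < \<infinity>" if "contam_fraction X m < min (1 / K) (1 - real p / K)"
      using that finite[OF \<open>1 \<le> m\<close>] by simp
  qed
  moreover have "is_breakdown_fraction u t X 0" if "real n + 1 \<le> K"
  proof -
    have "1 / K \<le> contam_fraction X m" if "1 \<le> m" for m
    proof -
      have "real n * 1 \<le> real n * real m" using that by (intro mult_left_mono) auto
      then have "real n + real m \<le> (real n + 1) * real m"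
        by (simp add: algebra_simps)
      also have "\<dots> \<le> K * real m"
        using \<open>real n + 1 \<le> K\<close> by (intro mult_right_mono) auto
      finally show ?thesis
        using K0 that by (simp add: contam_fraction_def n_def field_simps)
    qed
    \<comment> \<open>Fractions are never negative, so the finiteness half is vacuous for the value
      0.\<close>
    moreover have contam_nonneg: "0 \<le> contam_fraction X m" for m
      by (simp add: contam_fraction_def)
    ultimately show ?thesis
      unfolding is_breakdown_fraction_def using infinite contam_nonneg
      by (meson leD)
  qed
  ultimately show ?thesis by (simp add: K_def p_def n_def)
qed

end
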